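(* Let $K$ be a field of characteristic $0$. The $\mathbf{Z}^2$-graded algebras $C_{5,2}$ and $C_{6,2}$ over $K$ have no bigraded system of parameters.
   Context: Let $M_n=M_n(K)$ be the algebra of $n\times n$ matrices over $K$. The group $\mathrm{GL}_n=\mathrm{GL}_n(K)$ acts on $M_n^2=M_n\times M_n$ by simultaneous conjugation, $a\cdot(x,y)=(axa^{-1},aya^{-1})$, and hence on the algebra $K[M_n^2]$ of polynomial functions on $M_n^2$. Put $C_{n,2}=K[M_n^2]^{\mathrm{GL}_n}$, the algebra of invariants. The entries of $x$ and $y$ are viewed as coordinate functions on $M_n^2$; giving the entries of $x$ degree $(1,0)$ and the entries of $y$ degree $(0,1)$ makes $C_{n,2}$ a $\mathbf{Z}^2$-graded (bigraded) algebra. A bigraded system of parameters of $C_{n,2}$ is a finite set $\{P_1,\ldots,P_m\}$ of algebraically independent elements of $C_{n,2}$, each homogeneous with respect to the $\mathbf{Z}^2$-grading and of positive total degree, such that $C_{n,2}$ is a finitely generated module over the polynomial algebra $K[P_1,\ldots,P_m]$. *)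

theory Defs
  imports "HOL-Analysis.Analysis" "HOL-Library.Poly_Mapping"
begin

(* Polynomials over 'a in variables indexed by 'v: finitely supported maps from monomials to
   coefficients, a monomial being a finitely supported exponent map. *)
type_synonym ('v, 'a) mpolynomial = "('v \<Rightarrow>\<^sub>0 nat) \<Rightarrow>\<^sub>0 'a"

definition mpoly_vars :: "('v, 'a::zero) mpolynomial \<Rightarrow> 'v set" where
  "mpoly_vars p = (\<Union>m \<in> Poly_Mapping.keys p. Poly_Mapping.keys m)"

definition mpoly_eval :: "('v \<Rightarrow> 'a) \<Rightarrow> ('v, 'a::comm_ring_1) mpolynomial \<Rightarrow> 'a" where
  "mpoly_eval v p = (\<Sum>m \<in> Poly_Mapping.keys p.
     Poly_Mapping.lookup p m * (\<Prod>i \<in> Poly_Mapping.keys m. v i ^ Poly_Mapping.lookup m i))"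

(* For K-valued functions, the operations of the algebra are pointwise, so substituting the
   functions P in S into p gives the function mapping z to the value of p at the values P z. *)
definition mpoly_subst :: "('z \<Rightarrow> 'a, 'a::comm_ring_1) mpolynomial \<Rightarrow> 'z \<Rightarrow> 'a" where
  "mpoly_subst p = (\<lambda>z. mpoly_eval (\<lambda>P. P z) p)"

definition generated_subalgebra :: "('z \<Rightarrow> 'a::comm_ring_1) set \<Rightarrow> ('z \<Rightarrow> 'a) set" where
  "generated_subalgebra S = {mpoly_subst p | p. mpoly_vars p \<subseteq> S}"

definition algebraically_independent :: "('z \<Rightarrow> 'a::comm_ring_1) set \<Rightarrow> bool" where
  "algebraically_independent S \<longleftrightarrow>
     (\<forall>p. mpoly_vars p \<subseteq> S \<longrightarrow> mpoly_subst p = (\<lambda>_. 0) \<longrightarrow> p = 0)"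

definition finitely_generated_over :: "('z \<Rightarrow> 'a::comm_ring_1) set \<Rightarrow> ('z \<Rightarrow> 'a) set \<Rightarrow> bool" where
  "finitely_generated_over C R \<longleftrightarrow>
     (\<exists>B. finite B \<and> B \<subseteq> C \<and>
       (\<forall>f \<in> C. \<exists>r. (\<forall>b \<in> B. r b \<in> R) \<and> f = (\<lambda>z. \<Sum>b \<in> B. r b z * b z)))"


type_synonym ('a, 'n) mat_pair = "('a^'n^'n) \<times> ('a^'n^'n)"

(* Coordinates on pairs (x, y): Inl (i, j) is the entry x_ij, Inr (i, j) is the entry y_ij. *)
type_synonym 'n coord = "'n \<times> 'n + 'n \<times> 'n"

definition coord_fun :: "('a, 'n::finite) mat_pair \<Rightarrow> 'n coord \<Rightarrow> 'a" where
  "coord_fun z = case_sum (\<lambda>(i, j). fst z $ i $ j) (\<lambda>(i, j). snd z $ i $ j)"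

definition pair_polynomial_functions :: "(('a::field, 'n::finite) mat_pair \<Rightarrow> 'a) set" where
  "pair_polynomial_functions = {\<lambda>z. mpoly_eval (coord_fun z) p | p. True}"

definition simultaneous_conj ::
    "'a::field^'n^'n \<Rightarrow> ('a, 'n::finite) mat_pair \<Rightarrow> ('a, 'n) mat_pair" where
  "simultaneous_conj a z = (a ** fst z ** matrix_inv a, a ** snd z ** matrix_inv a)"

definition pair_invariants :: "(('a::field, 'n::finite) mat_pair \<Rightarrow> 'a) set" where
  "pair_invariants = {f \<in> pair_polynomial_functions.
     \<forall>a z. invertible a \<longrightarrow> f (simultaneous_conj a z) = f z}"

definition monomial_bidegree :: "('n::finite coord \<Rightarrow>\<^sub>0 nat) \<Rightarrow> nat \<times> nat" where
  "monomial_bidegree m =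
     (\<Sum>ij \<in> UNIV. Poly_Mapping.lookup m (Inl ij), \<Sum>ij \<in> UNIV. Poly_Mapping.lookup m (Inr ij))"

(* The zero function is homogeneous of every bidegree. *)
definition bihomogeneous :: "nat \<times> nat \<Rightarrow> (('a::field, 'n::finite) mat_pair \<Rightarrow> 'a) \<Rightarrow> bool" where
  "bihomogeneous d f \<longleftrightarrow>
     (\<exists>p. f = (\<lambda>z. mpoly_eval (coord_fun z) p) \<and>
          (\<forall>m \<in> Poly_Mapping.keys p. monomial_bidegree m = d))"

definition bigraded_system_of_parameters ::
    "(('a::field, 'n::finite) mat_pair \<Rightarrow> 'a) set \<Rightarrow> bool" where
  "bigraded_system_of_parameters S \<longleftrightarrow>
     finite S \<and> S \<subseteq> pair_invariants \<and> algebraically_independent S \<and>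
     (\<forall>P \<in> S. \<exists>d e. d + e > 0 \<and> bihomogeneous (d, e) P) \<and>
     finitely_generated_over pair_invariants (generated_subalgebra S)"

end

theory Submission
  imports Defs "HOL-Library.Function_Algebras" "HOL-Number_Theory.Cong"
begin

text \<open>
Let \<open>S\<close> be a bigraded system of parameters for pairs of \<open>n \<times> n\<close> matrices.  Two estimates for its
cardinality contradict each other when \<open>n\<close> is 5 or 6.

The upper bound is \<open>n\<^sup>2 + 1\<close>, the Krull dimension of the algebra of invariants
(\<open>card_system_of_parameters_le\<close>).  Over an algebraically closed field, conjugation moves a general
pair into an affine slice of that dimension: the first matrix becomes diagonal, and the entries off
the diagonal in one chosen row of the second become 1.  An invariant is determined by its restriction to the slice
(\<open>invariant_zero_if_zero_on_slice\<close>), so algebraically independent invariants restrict to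
independent polynomials in \<open>n\<^sup>2 + 1\<close> variables.  As \<open>K\<close> need not be algebraically closed, a general
matrix need not be diagonalizable over \<open>K\<close>; the density of the conjugates of the slice comes from a
tangent space computation at one point, carried along rational curves.

The lower bound distributes the parameters over rays.  For coprime \<open>a, b\<close> with \<open>a + b \<le> n\<close> let the
first matrix move the basis vector of level \<open>i\<close> to level \<open>i + b\<close> and the second one from level
\<open>i + a\<close> to level \<open>i\<close>.  Conjugation by a diagonal matrix of powers of 2 rescales such a pair, so that
an invariant of bidegree \<open>(d, e)\<close> vanishes on it unless \<open>b d = a e\<close>, that is, unless \<open>(d, e)\<close> lies on
the ray through \<open>(a, b)\<close>.  A word of length \<open>a + b\<close> in the two matrices runs around the cycle
through \<open>a + b\<close> consecutive levels and evaluates to a diagonal matrix whose nonzero entries are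
\<open>n + 1 - (a + b)\<close> independent cycle weights.  They are integral over the restrictions of the
invariants, because the values of the characteristic polynomial of that word are invariants.  The
invariants form a finite module over the algebra generated by \<open>S\<close>, and only the parameters with
bidegree on the ray survive the restriction; hence there are at least \<open>n + 1 - (a + b)\<close> of those
(\<open>card_parameters_on_ray_ge\<close>).

Different primitive directions give disjoint sets of parameters.  Summing over the directions with
\<open>a + b \<le> n\<close> gives at least 28 parameters for \<open>n = 5\<close>, where at most 26 are possible, and at least
41 for \<open>n = 6\<close>, where at most 37 are possible.

Both estimates use one counting argument (\<open>independent_family_card_le\<close>) in place of dimension
theory: if a module that is finite over an algebra with \<open>s\<close> generators contains 1 and is stable
under multiplication by \<open>r\<close> independent functions, then \<open>r \<le> s\<close>.
\<close>

section \<open>Algebras of functions\<close>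

text \<open>
The inductive presentation replaces the substitution into formal polynomials, so that statements
about polynomial expressions in given functions can be proved by induction.
\<close>

inductive_set subalgebra_gen :: "('y \<Rightarrow> 'a::comm_ring_1) set \<Rightarrow> ('y \<Rightarrow> 'a) set"
  for G where
  const: "(\<lambda>_. c) \<in> subalgebra_gen G"
| gen: "g \<in> G \<Longrightarrow> g \<in> subalgebra_gen G"
| add: "f \<in> subalgebra_gen G \<Longrightarrow> g \<in> subalgebra_gen G \<Longrightarrow> (\<lambda>y. f y + g y) \<in> subalgebra_gen G"
| mult: "f \<in> subalgebra_gen G \<Longrightarrow> g \<in> subalgebra_gen G \<Longrightarrow> (\<lambda>y. f y * g y) \<in> subalgebra_gen G"

lemma subalgebra_gen_sum:
  "(\<And>i. i \<in> I \<Longrightarrow> f i \<in> subalgebra_gen G) \<Longrightarrow> (\<lambda>y. \<Sum>i\<in>I. f i y) \<in> subalgebra_gen G"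
  by (induction I rule: infinite_finite_induct) (auto intro: subalgebra_gen.intros)

lemma subalgebra_gen_prod:
  "(\<And>i. i \<in> I \<Longrightarrow> f i \<in> subalgebra_gen G) \<Longrightarrow> (\<lambda>y. \<Prod>i\<in>I. f i y) \<in> subalgebra_gen G"
  by (induction I rule: infinite_finite_induct) (auto intro: subalgebra_gen.intros)

lemma subalgebra_gen_power:
  "f \<in> subalgebra_gen G \<Longrightarrow> (\<lambda>y. f y ^ k) \<in> subalgebra_gen G"
  by (induction k) (auto intro: subalgebra_gen.intros)

lemma subalgebra_gen_diff:
  assumes "f \<in> subalgebra_gen G" "g \<in> subalgebra_gen G"
  shows "(\<lambda>y. f y - g y) \<in> subalgebra_gen G"
proof -
  have "(\<lambda>y. f y + (-1) * g y) \<in> subalgebra_gen G"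
    by (intro subalgebra_gen.add subalgebra_gen.mult subalgebra_gen.const assms)
  then show ?thesis by simp
qed

lemma subalgebra_gen_comp:
  assumes "f \<in> subalgebra_gen G"
    and "\<And>g. g \<in> G \<Longrightarrow> (\<lambda>y. g (\<phi> y)) \<in> subalgebra_gen H"
  shows "(\<lambda>y. f (\<phi> y)) \<in> subalgebra_gen H"
  using assms(1) by induction (auto intro: subalgebra_gen.intros assms(2))

lemma mpoly_eval_superset:
  assumes "finite A" "Poly_Mapping.keys p \<subseteq> A"
  shows "mpoly_eval v p = (\<Sum>m\<in>A. Poly_Mapping.lookup p m *
           (\<Prod>i \<in> Poly_Mapping.keys m. v i ^ Poly_Mapping.lookup m i))"
  unfolding mpoly_eval_def
  by (rule sum.mono_neutral_left) (use assms in \<open>auto simp: in_keys_iff\<close>)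

lemma mpoly_eval_zero [simp]: "mpoly_eval v 0 = 0"
  by (simp add: mpoly_eval_def)

lemma mpoly_eval_add: "mpoly_eval v (p + q) = mpoly_eval v p + mpoly_eval v q"
proof -
  define A where "A = Poly_Mapping.keys p \<union> Poly_Mapping.keys q"
  have "finite A" "Poly_Mapping.keys p \<subseteq> A" "Poly_Mapping.keys q \<subseteq> A"
    "Poly_Mapping.keys (p + q) \<subseteq> A"
    using keys_add[of p q] by (auto simp: A_def)
  then show ?thesis
    by (simp add: mpoly_eval_superset[of A] lookup_add distrib_right sum.distrib)
qed

lemma mpoly_eval_sum: "mpoly_eval v (\<Sum>i\<in>I. p i) = (\<Sum>i\<in>I. mpoly_eval v (p i))"
  by (induction I rule: infinite_finite_induct) (auto simp: mpoly_eval_add)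

lemma mpoly_eval_single:
  "mpoly_eval v (Poly_Mapping.single m c) =
     c * (\<Prod>i \<in> Poly_Mapping.keys m. v i ^ Poly_Mapping.lookup m i)"
  by (simp add: mpoly_eval_def)

lemma monomial_eval_superset:
  fixes v :: "'v \<Rightarrow> 'a::comm_ring_1"
  assumes "finite A" "Poly_Mapping.keys m \<subseteq> A"
  shows "(\<Prod>i \<in> Poly_Mapping.keys m. v i ^ Poly_Mapping.lookup m i) =
         (\<Prod>i \<in> A. v i ^ Poly_Mapping.lookup m i)"
  by (rule prod.mono_neutral_left) (use assms in \<open>auto simp: in_keys_iff\<close>)

lemma mpoly_eval_mult: "mpoly_eval v (p * q) = mpoly_eval v p * mpoly_eval v q"
proof -
  have mono: "p = (\<Sum>m\<in>Poly_Mapping.keys p. Poly_Mapping.single m (Poly_Mapping.lookup p m))"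
    for p :: "('v, 'a) mpolynomial"
    by (rule poly_mapping_eqI)
       (auto simp: lookup_sum lookup_single when_def in_keys_iff sum.delta')
  have single: "mpoly_eval v (Poly_Mapping.single m c * Poly_Mapping.single n d) =
      mpoly_eval v (Poly_Mapping.single m c) * mpoly_eval v (Poly_Mapping.single n d)" for m n c d
  proof -
    define A where "A = Poly_Mapping.keys m \<union> Poly_Mapping.keys n"
    have A: "finite A" "Poly_Mapping.keys m \<subseteq> A" "Poly_Mapping.keys n \<subseteq> A"
      "Poly_Mapping.keys (m + n) \<subseteq> A"
      using keys_add[of m n] by (auto simp: A_def)
    have "(\<Prod>i \<in> Poly_Mapping.keys (m + n). v i ^ Poly_Mapping.lookup (m + n) i) =
        (\<Prod>i \<in> A. v i ^ Poly_Mapping.lookup m i) * (\<Prod>i \<in> A. v i ^ Poly_Mapping.lookup n i)"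
      by (subst monomial_eval_superset[OF A(1,4)]) (simp add: lookup_add power_add prod.distrib)
    then show ?thesis
      by (simp only: mult_single mpoly_eval_single monomial_eval_superset[OF A(1,2)]
          monomial_eval_superset[OF A(1,3)] mult_ac)
  qed
  show ?thesis
    by (subst (1 2) mono[of p], subst (1 2) mono[of q])
       (simp only: sum_product mpoly_eval_sum single)
qed

lemma generated_subalgebra_subset: "generated_subalgebra S \<subseteq> subalgebra_gen S"
proof
  fix f assume "f \<in> generated_subalgebra S"
  then obtain p where p: "f = mpoly_subst p" "mpoly_vars p \<subseteq> S"
    by (auto simp: generated_subalgebra_def)
  have "P \<in> subalgebra_gen S" if "m \<in> Poly_Mapping.keys p" "P \<in> Poly_Mapping.keys m" for m P
    by (rule subalgebra_gen.gen) (use that p(2) in \<open>auto simp: mpoly_vars_def\<close>)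
  then show "f \<in> subalgebra_gen S"
    unfolding p(1) mpoly_subst_def mpoly_eval_def
    by (intro subalgebra_gen_sum subalgebra_gen.mult subalgebra_gen.const
        subalgebra_gen_prod subalgebra_gen_power)
qed

definition coordinates :: "(('a::field, 'n::finite) mat_pair \<Rightarrow> 'a) set" where
  "coordinates = range (\<lambda>c z. coord_fun z c)"

lemma pair_polynomial_functions_eq: "pair_polynomial_functions = subalgebra_gen coordinates"
proof (intro equalityI subsetI)
  fix f :: "('a, 'n::finite) mat_pair \<Rightarrow> 'a"
  assume "f \<in> pair_polynomial_functions"
  then obtain p where p: "f = (\<lambda>z. mpoly_eval (coord_fun z) p)"
    by (auto simp: pair_polynomial_functions_def)
  have "(\<lambda>z. coord_fun z c) \<in> subalgebra_gen coordinates" for c :: "'n coord"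
    by (rule subalgebra_gen.gen) (simp add: coordinates_def)
  then show "f \<in> subalgebra_gen coordinates"
    unfolding p mpoly_eval_def
    by (intro subalgebra_gen_sum subalgebra_gen.mult subalgebra_gen.const
        subalgebra_gen_prod subalgebra_gen_power)
next
  fix f :: "('a, 'n::finite) mat_pair \<Rightarrow> 'a"
  assume "f \<in> subalgebra_gen coordinates"
  then have "\<exists>p. f = (\<lambda>z. mpoly_eval (coord_fun z) p)"
  proof induction
    case (const c)
    show ?case
      by (intro exI[of _ "Poly_Mapping.single 0 c"]) (simp add: mpoly_eval_single)
  next
    case (gen g)
    then obtain c where "g = (\<lambda>z. coord_fun z c)" by (auto simp: coordinates_def)
    then show ?case
      by (intro exI[of _ "Poly_Mapping.single (Poly_Mapping.single c 1) 1"])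
         (simp add: mpoly_eval_single)
  next
    case (add f g)
    then obtain p q where "f = (\<lambda>z. mpoly_eval (coord_fun z) p)"
      "g = (\<lambda>z. mpoly_eval (coord_fun z) q)" by auto
    then show ?case
      by (intro exI[of _ "p + q"]) (simp add: mpoly_eval_add)
  next
    case (mult f g)
    then obtain p q where "f = (\<lambda>z. mpoly_eval (coord_fun z) p)"
      "g = (\<lambda>z. mpoly_eval (coord_fun z) q)" by auto
    then show ?case
      by (intro exI[of _ "p * q"]) (simp add: mpoly_eval_mult)
  qed
  then show "f \<in> pair_polynomial_functions"
    by (auto simp: pair_polynomial_functions_def)
qed

section \<open>Independent functions in a finite module\<close>

text \<open>
The functions on a set form a vector space, so that a family of functions inside the span of
fewer functions satisfies a linear relation.
\<close>

interpretation fun_space: vector_space "\<lambda>(c::'a::field) (f::'y \<Rightarrow> 'a). (\<lambda>y. c * f y)"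
  by unfold_locales (auto simp: fun_eq_iff algebra_simps)

lemma sum_fun_apply: "(\<Sum>i\<in>I. f i) y = (\<Sum>i\<in>I. f i y)"
  for f :: "'i \<Rightarrow> 'y \<Rightarrow> 'a::comm_monoid_add"
  by (induction I rule: infinite_finite_induct) auto

lemma linear_relation_in_span:
  fixes v :: "'i \<Rightarrow> 'y \<Rightarrow> 'a::field"
  assumes "finite I" "finite T" "\<And>i. i \<in> I \<Longrightarrow> v i \<in> fun_space.span T" "card T < card I"
  obtains c where "\<exists>i\<in>I. c i \<noteq> 0" "\<And>y. (\<Sum>i\<in>I. c i * v i y) = 0"
proof (cases "inj_on v I")
  case True
  have "fun_space.dependent (v ` I)"
  proof (rule ccontr)
    assume "fun_space.independent (v ` I)"
    from fun_space.independent_span_bound[OF assms(2) this] assms(3)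
    have "card (v ` I) \<le> card T" by auto
    then show False using True assms(4) by (simp add: card_image)
  qed
  then obtain u where u: "\<exists>f\<in>v ` I. u f \<noteq> 0" "(\<Sum>f\<in>v ` I. (\<lambda>y. u f * f y)) = 0"
    using assms(1) by (subst (asm) fun_space.dependent_finite) auto
  have "(\<Sum>i\<in>I. u (v i) * v i y) = 0" for y
  proof -
    have "(\<Sum>i\<in>I. (\<lambda>y. u (v i) * v i y)) = 0"
      using u(2) by (simp add: sum.reindex[OF True])
    from fun_cong[OF this, of y] show ?thesis by (simp add: sum_fun_apply)
  qed
  then show ?thesis using that[of "\<lambda>i. u (v i)"] u(1) by auto
next
  case False
  then obtain i j where ij: "i \<in> I" "j \<in> I" "i \<noteq> j" "v i = v j" by (auto simp: inj_on_def)
  let ?c = "\<lambda>k. if k = i then 1 else if k = j then -1 else (0::'a)"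
  have "(\<Sum>k\<in>I. ?c k * v k y) = (\<Sum>k\<in>{i,j}. ?c k * v k y)" for y
    by (rule sum.mono_neutral_right) (use ij assms(1) in auto)
  then have "(\<Sum>k\<in>I. ?c k * v k y) = 0" for y using ij by simp
  moreover have "\<exists>k\<in>I. ?c k \<noteq> 0" using ij(1) by (intro bexI[of _ i]) auto
  ultimately show ?thesis using that[of ?c] by blast
qed

lemma span_mult:
  fixes f g :: "'y \<Rightarrow> 'a::field"
  assumes f: "f \<in> fun_space.span A" and g: "g \<in> fun_space.span B"
    and AB: "\<And>a b. a \<in> A \<Longrightarrow> b \<in> B \<Longrightarrow> (\<lambda>y. a y * b y) \<in> fun_space.span C"
  shows "(\<lambda>y. f y * g y) \<in> fun_space.span C"
proof -
  have 1: "(\<lambda>y. a y * g y) \<in> fun_space.span C" if "a \<in> A" for a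
    using g
  proof (induction rule: fun_space.span_induct_alt)
    case base
    then show ?case using fun_space.span_zero[of C] by (simp add: zero_fun_def)
  next
    case (step c x y)
    have "(\<lambda>z. a z * ((\<lambda>y. c * x y) + y) z)
        = (\<lambda>z. c * (\<lambda>z. a z * x z) z) + (\<lambda>z. a z * y z)"
      by (auto simp: algebra_simps)
    then show ?case
      using fun_space.span_add[OF fun_space.span_scale[OF AB[OF that step(1)], of c] step(2)]
      by simp
  qed
  show ?thesis
    using f
  proof (induction rule: fun_space.span_induct_alt)
    case base
    then show ?case using fun_space.span_zero[of C] by (simp add: zero_fun_def)
  next
    case (step c x y)
    have "(\<lambda>z. ((\<lambda>y. c * x y) + y) z * g z)
        = (\<lambda>z. c * (\<lambda>z. x z * g z) z) + (\<lambda>z. y z * g z)"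
      by (auto simp: algebra_simps)
    then show ?case
      using fun_space.span_add[OF fun_space.span_scale[OF 1[OF step(1)], of c] step(2)]
      by simp
  qed
qed

text \<open>
The exponents are bounded one by one and not in total.  This makes the number of monomials a power,
which is all that the comparison of growth rates requires.
\<close>

definition monomials_upto :: "'j set \<Rightarrow> ('j \<Rightarrow> 'y \<Rightarrow> 'a::comm_ring_1) \<Rightarrow> nat \<Rightarrow> ('y \<Rightarrow> 'a) set" where
  "monomials_upto J g E = (\<lambda>u y. \<Prod>j\<in>J. g j y ^ u j) ` (J \<rightarrow>\<^sub>E {..E})"

lemma monomials_uptoI:
  assumes "\<And>j. j \<in> J \<Longrightarrow> u j \<le> E" "\<And>y. f y = (\<Prod>j\<in>J. g j y ^ u j)"
  shows "f \<in> monomials_upto J g E"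
  unfolding monomials_upto_def
proof (rule image_eqI[of _ _ "restrict u J"])
  show "f = (\<lambda>y. \<Prod>j\<in>J. g j y ^ restrict u J j)"
    by (rule ext) (simp add: assms(2))
qed (use assms(1) in auto)

lemma monomials_uptoE:
  assumes "f \<in> monomials_upto J g E"
  obtains u where "\<And>j. j \<in> J \<Longrightarrow> u j \<le> E" "\<And>y. f y = (\<Prod>j\<in>J. g j y ^ u j)"
  using assms unfolding monomials_upto_def by (auto simp: PiE_iff)

lemma monomials_upto_mono: "E \<le> E' \<Longrightarrow> monomials_upto J g E \<subseteq> monomials_upto J g E'"
  unfolding monomials_upto_def by (intro image_mono PiE_mono) auto

lemma monomials_upto_mult:
  assumes "f \<in> monomials_upto J g E" "f' \<in> monomials_upto J g E'"
  shows "(\<lambda>y. f y * f' y) \<in> monomials_upto J g (E + E')"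
proof -
  obtain u u' where u: "\<And>j. j \<in> J \<Longrightarrow> u j \<le> E" "\<And>y. f y = (\<Prod>j\<in>J. g j y ^ u j)"
    "\<And>j. j \<in> J \<Longrightarrow> u' j \<le> E'" "\<And>y. f' y = (\<Prod>j\<in>J. g j y ^ u' j)"
    using assms[THEN monomials_uptoE] by metis
  show ?thesis
    by (rule monomials_uptoI[of _ "\<lambda>j. u j + u' j"])
       (use u in \<open>auto simp: power_add prod.distrib add_mono\<close>)
qed

lemma finite_monomials_upto: "finite J \<Longrightarrow> finite (monomials_upto J g E)"
  by (auto simp: monomials_upto_def intro!: finite_PiE)

lemma card_monomials_upto: "finite J \<Longrightarrow> card (monomials_upto J g E) \<le> (E + 1) ^ card J"
  unfolding monomials_upto_def
  by (rule order.trans[OF card_image_le]) (auto simp: card_PiE intro!: finite_PiE)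

lemma subalgebra_gen_in_span_monomials:
  fixes g :: "'j \<Rightarrow> 'y \<Rightarrow> 'a::field"
  assumes J: "finite J" and f: "f \<in> subalgebra_gen (g ` J)"
  shows "\<exists>E. f \<in> fun_space.span (monomials_upto J g E)"
  using f
proof induction
  case (const c)
  have "(\<lambda>_. 1) \<in> monomials_upto J g 0"
    by (rule monomials_uptoI[of _ "\<lambda>_. 0"]) auto
  from fun_space.span_scale[OF fun_space.span_base[OF this], of c] show ?case by auto
next
  case (gen h)
  then obtain j where j: "j \<in> J" "h = g j" by auto
  have "h \<in> monomials_upto J g 1"
  proof (rule monomials_uptoI[of _ "\<lambda>i. if i = j then 1 else 0"])
    fix y
    have "(\<Prod>i\<in>J. g i y ^ (if i = j then 1 else 0)) = (\<Prod>i\<in>{j}. g i y ^ (if i = j then 1 else 0))"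
      by (rule prod.mono_neutral_right) (use J j in auto)
    then show "h y = (\<Prod>i\<in>J. g i y ^ (if i = j then 1 else 0))" using j by simp
  qed auto
  then show ?case by (auto intro: fun_space.span_base)
next
  case (add f h)
  then obtain E E' where "f \<in> fun_space.span (monomials_upto J g E)"
    "h \<in> fun_space.span (monomials_upto J g E')" by auto
  then have "f \<in> fun_space.span (monomials_upto J g (E + E'))"
    "h \<in> fun_space.span (monomials_upto J g (E + E'))"
    using fun_space.span_mono[OF monomials_upto_mono[of E "E + E'"]]
      fun_space.span_mono[OF monomials_upto_mono[of E' "E + E'"]] by force+
  from fun_space.span_add[OF this] show ?case by (auto simp: plus_fun_def)
next
  case (mult f h)
  then obtain E E' where "f \<in> fun_space.span (monomials_upto J g E)"
    "h \<in> fun_space.span (monomials_upto J g E')" by auto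
  from span_mult[OF this fun_space.span_base[OF monomials_upto_mult]] show ?case by blast
qed

definition module_span :: "('y \<Rightarrow> 'a::comm_ring_1) set \<Rightarrow> ('y \<Rightarrow> 'a) set \<Rightarrow> ('y \<Rightarrow> 'a) set" where
  "module_span R B = {\<lambda>y. \<Sum>b\<in>B. r b y * b y | r. \<forall>b\<in>B. r b \<in> R}"

definition monomials_times :: "'j set \<Rightarrow> ('j \<Rightarrow> 'y \<Rightarrow> 'a::comm_ring_1) \<Rightarrow> ('y \<Rightarrow> 'a) set \<Rightarrow> nat \<Rightarrow> ('y \<Rightarrow> 'a) set" where
  "monomials_times J g B E = (\<lambda>(m, b) y. m y * b y) ` (monomials_upto J g E \<times> B)"

lemma monomials_times_mono: "E \<le> E' \<Longrightarrow> monomials_times J g B E \<subseteq> monomials_times J g B E'"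
  unfolding monomials_times_def using monomials_upto_mono[of E E' J g] by (intro image_mono) auto

lemma finite_monomials_times: "finite J \<Longrightarrow> finite B \<Longrightarrow> finite (monomials_times J g B E)"
  unfolding monomials_times_def by (simp add: finite_monomials_upto)

lemma card_monomials_times:
  assumes "finite J" "finite B"
  shows "card (monomials_times J g B E) \<le> (E + 1) ^ card J * card B"
proof -
  have "card (monomials_times J g B E) \<le> card (monomials_upto J g E \<times> B)"
    unfolding monomials_times_def by (rule card_image_le) (simp add: assms finite_monomials_upto)
  also have "\<dots> \<le> (E + 1) ^ card J * card B"
    unfolding card_cartesian_product using card_monomials_upto[OF assms(1)] by (rule mult_right_mono) simp
  finally show ?thesis .
qed

lemma monomials_times_span_mono:
  "E \<le> E' \<Longrightarrow> f \<in> fun_space.span (monomials_times J g B E) \<Longrightarrow>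
     f \<in> fun_space.span (monomials_times J g B E')"
  using fun_space.span_mono[OF monomials_times_mono] by blast

text \<open>
The coefficients of one element of the module are finitely many polynomials, and together they have
bounded exponents.  This turns membership in the module into membership in a finite dimensional
space.
\<close>

lemma module_span_in_span_monomials:
  fixes g :: "'j \<Rightarrow> 'y \<Rightarrow> 'a::field"
  assumes J: "finite J" and B: "finite B" and f: "f \<in> module_span (subalgebra_gen (g ` J)) B"
  shows "\<exists>E. f \<in> fun_space.span (monomials_times J g B E)"
proof -
  obtain r where r: "\<And>b. b \<in> B \<Longrightarrow> r b \<in> subalgebra_gen (g ` J)"
    "f = (\<lambda>y. \<Sum>b\<in>B. r b y * b y)"
    using f by (auto simp: module_span_def)
  have "\<forall>b\<in>B. \<exists>E. r b \<in> fun_space.span (monomials_upto J g E)"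
    using subalgebra_gen_in_span_monomials[OF J r(1)] by blast
  then obtain E where E: "\<And>b. b \<in> B \<Longrightarrow> r b \<in> fun_space.span (monomials_upto J g (E b))"
    by metis
  define M where "M = (\<Sum>b\<in>B. E b)"
  have "(\<lambda>y. r b y * b y) \<in> fun_space.span (monomials_times J g B M)" if b: "b \<in> B" for b
  proof (rule span_mult[OF E[OF b] fun_space.span_base[of b "{b}"]])
    fix m b' assume "m \<in> monomials_upto J g (E b)" "b' \<in> {b}"
    then have "(\<lambda>y. m y * b' y) \<in> monomials_times J g B (E b)"
      using b by (auto simp: monomials_times_def)
    moreover have "E b \<le> M" unfolding M_def by (rule member_le_sum) (use b B in auto)
    ultimately show "(\<lambda>y. m y * b' y) \<in> fun_space.span (monomials_times J g B M)"
      using monomials_times_span_mono fun_space.span_base by blast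
  qed simp
  then have "(\<Sum>b\<in>B. (\<lambda>y. r b y * b y)) \<in> fun_space.span (monomials_times J g B M)"
    by (rule fun_space.span_sum)
  moreover have "(\<Sum>b\<in>B. (\<lambda>y. r b y * b y)) = f"
    by (rule ext) (simp add: sum_fun_apply r(2))
  ultimately show ?thesis by auto
qed

text \<open>
Algebraic independence of an indexed family, phrased as linear independence of the monomials in
every box of exponents.  The index set allows a restricted family to repeat functions without
losing count of its members.
\<close>

definition independent_family :: "'i set \<Rightarrow> ('i \<Rightarrow> 'y \<Rightarrow> 'a::comm_ring_1) \<Rightarrow> bool" where
  "independent_family I f \<longleftrightarrow> (\<forall>D c. (\<forall>y. (\<Sum>m\<in>I \<rightarrow>\<^sub>E {..<D}. c m * (\<Prod>i\<in>I. f i y ^ m i)) = 0) \<longrightarrow>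
     (\<forall>m\<in>I \<rightarrow>\<^sub>E {..<D}. c m = 0))"

text \<open>
Multiplication by one of the \<open>f i\<close> raises the exponents in the \<open>g j\<close> by at most a fixed \<open>c\<close>,
because finitely many products \<open>f i * b\<close> have to be expanded.  Hence the \<open>D ^ card I\<close> monomials in
the \<open>f i\<close> with exponents below \<open>D\<close> lie in a space of dimension at most \<open>card B * (C * D) ^ card J\<close>
with \<open>C\<close> independent of \<open>D\<close>.  For large \<open>D\<close> this contradicts \<open>card J < card I\<close>.
\<close>

theorem independent_family_card_le:
  fixes f :: "'i \<Rightarrow> 'y \<Rightarrow> 'a::field" and g :: "'j \<Rightarrow> 'y \<Rightarrow> 'a"
  assumes I: "finite I" and J: "finite J" and B: "finite B"
    and indep: "independent_family I f"
    and one: "(\<lambda>_. 1) \<in> module_span (subalgebra_gen (g ` J)) B"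
    and closed: "\<And>i b. i \<in> I \<Longrightarrow> b \<in> B \<Longrightarrow>
      (\<lambda>y. f i y * b y) \<in> module_span (subalgebra_gen (g ` J)) B"
  shows "card I \<le> card J"
proof (rule ccontr)
  let ?W = "\<lambda>E. fun_space.span (monomials_times J g B E)"
  assume "\<not> card I \<le> card J"
  then have less: "card J < card I" by simp
  obtain E0 where E0: "(\<lambda>_. 1) \<in> ?W E0"
    using module_span_in_span_monomials[OF J B one] by auto
  have "\<forall>i\<in>I. \<forall>b\<in>B. \<exists>E. (\<lambda>y. f i y * b y) \<in> ?W E"
    using module_span_in_span_monomials[OF J B closed] by blast
  then obtain E1 where E1: "\<And>i b. i \<in> I \<Longrightarrow> b \<in> B \<Longrightarrow> (\<lambda>y. f i y * b y) \<in> ?W (E1 i b)"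
    by metis
  define c where "c = E0 + (\<Sum>(i, b)\<in>I \<times> B. E1 i b)"
  have c: "(\<lambda>y. f i y * b y) \<in> ?W c" if "i \<in> I" "b \<in> B" for i b
  proof -
    have "(case (i, b) of (i, b) \<Rightarrow> E1 i b) \<le> (\<Sum>(i, b)\<in>I \<times> B. E1 i b)"
      by (rule member_le_sum) (use that I B in auto)
    then have "E1 i b \<le> c" by (simp add: c_def)
    then show ?thesis using monomials_times_span_mono E1[OF that] by blast
  qed
  have step: "(\<lambda>y. f i y * h y) \<in> ?W (E + c)" if i: "i \<in> I" and h: "h \<in> ?W E" for i h E
  proof (rule span_mult[OF fun_space.span_base[of "f i" "{f i}"] h])
    fix a p assume "a \<in> {f i}" "p \<in> monomials_times J g B E"
    then obtain m b where p: "a = f i" "m \<in> monomials_upto J g E" "b \<in> B" "p = (\<lambda>y. m y * b y)"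
      by (auto simp: monomials_times_def)
    have "(\<lambda>y. m y * (f i y * b y)) \<in> ?W (E + c)"
    proof (rule span_mult[OF fun_space.span_base[of m "{m}"] c[OF i p(3)]])
      fix m' q assume "m' \<in> {m}" "q \<in> monomials_times J g B c"
      then obtain m2 b2 where q: "m' = m" "m2 \<in> monomials_upto J g c" "b2 \<in> B" "q = (\<lambda>y. m2 y * b2 y)"
        by (auto simp: monomials_times_def)
      have "(\<lambda>y. m' y * q y) = (\<lambda>(m, b) y. m y * b y) ((\<lambda>y. m y * m2 y), b2)"
        by (auto simp: q mult_ac)
      then have "(\<lambda>y. m' y * q y) \<in> monomials_times J g B (E + c)"
        unfolding monomials_times_def using monomials_upto_mult[OF p(2) q(2)] q(3) by blast
      then show "(\<lambda>y. m' y * q y) \<in> ?W (E + c)" by (rule fun_space.span_base)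
    qed simp
    moreover have "(\<lambda>y. a y * p y) = (\<lambda>y. m y * (f i y * b y))" by (auto simp: p mult_ac)
    ultimately show "(\<lambda>y. a y * p y) \<in> ?W (E + c)" by simp
  qed simp
  have pow: "(\<lambda>y. f i y ^ k * h y) \<in> ?W (E + k * c)" if "i \<in> I" "h \<in> ?W E" for i h E k
  proof (induction k)
    case 0
    then show ?case using that by simp
  next
    case (Suc k)
    from step[OF that(1) this] show ?case by (simp add: mult_ac add_ac)
  qed
  have prods: "(\<lambda>y. \<Prod>i\<in>I'. f i y ^ m i) \<in> ?W (c + (\<Sum>i\<in>I'. m i * c))" if "I' \<subseteq> I" for m I'
    using finite_subset[OF that I] that
  proof (induction I')
    case empty
    have "E0 \<le> c" by (simp add: c_def)
    then show ?case using monomials_times_span_mono E0 by fastforce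
  next
    case (insert i I')
    then have "i \<in> I" "(\<lambda>y. \<Prod>i\<in>I'. f i y ^ m i) \<in> ?W (c + (\<Sum>i\<in>I'. m i * c))" by auto
    from pow[OF this, of "m i"] insert(1,2) show ?case by (simp add: add_ac)
  qed
  define C where "C = c + card I * c + 1"
  \<comment> \<open>With this box size the monomials outnumber the spanning set.\<close>
  define D where "D = card B * C ^ card J + 1"
  define T where "T = monomials_times J g B (c + card I * (D * c))"
  have inT: "(\<lambda>y. \<Prod>i\<in>I. f i y ^ m i) \<in> fun_space.span T" if "m \<in> I \<rightarrow>\<^sub>E {..<D}" for m
  proof -
    have "(\<Sum>i\<in>I. m i * c) \<le> (\<Sum>i\<in>I. D * c)"
      by (intro sum_mono mult_right_mono) (use that in \<open>auto simp: PiE_iff less_imp_le\<close>)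
    then have "c + (\<Sum>i\<in>I. m i * c) \<le> c + card I * (D * c)" by simp
    then show ?thesis unfolding T_def using monomials_times_span_mono prods[OF order_refl] by blast
  qed
  have "c + card I * (D * c) + 1 \<le> C * D"
  proof -
    have "D \<ge> 1" by (simp add: D_def)
    then have "(c + 1) * 1 \<le> (c + 1) * D" by (intro mult_left_mono) auto
    then show ?thesis by (simp add: C_def algebra_simps)
  qed
  then have "(c + card I * (D * c) + 1) ^ card J * card B \<le> (C * D) ^ card J * card B"
    by (intro mult_right_mono power_mono) auto
  then have "card T \<le> (C * D) ^ card J * card B"
    using card_monomials_times[OF J B] unfolding T_def by (rule order.trans[rotated])
  also have "\<dots> = card B * C ^ card J * D ^ card J" by (simp add: power_mult_distrib)
  also have "\<dots> < D * D ^ card J" by (simp add: D_def)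
  also have "\<dots> = D ^ Suc (card J)" by simp
  also have "\<dots> \<le> D ^ card I" by (rule power_increasing) (use less in \<open>auto simp: D_def\<close>)
  also have "\<dots> = card (I \<rightarrow>\<^sub>E {..<D})" using I by (simp add: card_PiE)
  finally have "card T < card (I \<rightarrow>\<^sub>E {..<D})" .
  moreover have "finite T" unfolding T_def by (rule finite_monomials_times[OF J B])
  moreover have "finite (I \<rightarrow>\<^sub>E {..<D})" using I by (simp add: finite_PiE)
  ultimately obtain k where k: "\<exists>m\<in>I \<rightarrow>\<^sub>E {..<D}. k m \<noteq> 0"
    "\<And>y. (\<Sum>m\<in>I \<rightarrow>\<^sub>E {..<D}. k m * (\<Prod>i\<in>I. f i y ^ m i)) = 0"
    using linear_relation_in_span[where v = "\<lambda>m y. \<Prod>i\<in>I. f i y ^ m i", OF _ _ inT] by blast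
  then show False using indep k unfolding independent_family_def by blast
qed

section \<open>Rational functions regular at zero\<close>

text \<open>
Conjugation by \<open>1 + e A\<close> is rational in \<open>e\<close>.  The functions below form the local ring of the affine
line at 0, except that the values at zeros of the denominator are arbitrary: there the matrix
inverse is not the one given by Cramer's rule.
\<close>

definition regular_at_zero :: "('a::field \<Rightarrow> 'a) \<Rightarrow> bool" where
  "regular_at_zero h \<longleftrightarrow>
     (\<exists>p q. poly q 0 \<noteq> 0 \<and> (\<forall>e. poly q e \<noteq> 0 \<longrightarrow> h e = poly p e / poly q e))"

lemma regular_at_zeroE:
  assumes "regular_at_zero h"
  obtains p q where "poly q 0 \<noteq> 0" "\<And>e. poly q e \<noteq> 0 \<Longrightarrow> h e = poly p e / poly q e"
  using assms unfolding regular_at_zero_def by blast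

lemma regular_at_zeroI:
  assumes "poly q 0 \<noteq> 0" "\<And>e. poly q e \<noteq> 0 \<Longrightarrow> h e = poly p e / poly q e"
  shows "regular_at_zero h"
  using assms unfolding regular_at_zero_def by blast

lemma regular_at_zero_poly: "regular_at_zero (\<lambda>e. poly p e)"
  unfolding regular_at_zero_def by (intro exI[of _ p] exI[of _ 1]) simp

lemma regular_at_zero_const [simp]: "regular_at_zero (\<lambda>_. c)"
  using regular_at_zero_poly[of "[:c:]"] by simp

lemma regular_at_zero_ident [simp]: "regular_at_zero (\<lambda>e. e)"
  using regular_at_zero_poly[of "[:0, 1:]"] by simp

lemma regular_at_zero_add:
  assumes "regular_at_zero h" "regular_at_zero k"
  shows "regular_at_zero (\<lambda>e. h e + k e)"
proof -
  obtain p q p' q' where "poly q 0 \<noteq> 0" "\<And>e. poly q e \<noteq> 0 \<Longrightarrow> h e = poly p e / poly q e"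
    "poly q' 0 \<noteq> 0" "\<And>e. poly q' e \<noteq> 0 \<Longrightarrow> k e = poly p' e / poly q' e"
    using assms[THEN regular_at_zeroE] by metis
  then show ?thesis
    by (intro regular_at_zeroI[of "q * q'" _ "p * q' + p' * q"]) (auto simp: add_frac_eq)
qed

lemma regular_at_zero_mult:
  assumes "regular_at_zero h" "regular_at_zero k"
  shows "regular_at_zero (\<lambda>e. h e * k e)"
proof -
  obtain p q p' q' where "poly q 0 \<noteq> 0" "\<And>e. poly q e \<noteq> 0 \<Longrightarrow> h e = poly p e / poly q e"
    "poly q' 0 \<noteq> 0" "\<And>e. poly q' e \<noteq> 0 \<Longrightarrow> k e = poly p' e / poly q' e"
    using assms[THEN regular_at_zeroE] by metis
  then show ?thesis
    by (intro regular_at_zeroI[of "q * q'" _ "p * p'"]) auto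
qed

lemma regular_at_zero_sum:
  "(\<And>i. i \<in> I \<Longrightarrow> regular_at_zero (h i)) \<Longrightarrow> regular_at_zero (\<lambda>e. \<Sum>i\<in>I. h i e)"
  by (induction I rule: infinite_finite_induct) (auto intro: regular_at_zero_add)

lemma regular_at_zero_prod:
  "(\<And>i. i \<in> I \<Longrightarrow> regular_at_zero (h i)) \<Longrightarrow> regular_at_zero (\<lambda>e. \<Prod>i\<in>I. h i e)"
  by (induction I rule: infinite_finite_induct) (auto intro: regular_at_zero_mult)

lemma regular_at_zero_power: "regular_at_zero h \<Longrightarrow> regular_at_zero (\<lambda>e. h e ^ k)"
  by (induction k) (auto intro: regular_at_zero_mult)

lemma regular_at_zero_quotient:
  assumes "regular_at_zero h" "regular_at_zero d" "d 0 \<noteq> 0"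
    and u: "\<And>e. d e \<noteq> 0 \<Longrightarrow> u e = h e / d e"
  shows "regular_at_zero u"
proof -
  obtain p q p' q' where *: "poly q 0 \<noteq> 0" "\<And>e. poly q e \<noteq> 0 \<Longrightarrow> h e = poly p e / poly q e"
    "poly q' 0 \<noteq> 0" "\<And>e. poly q' e \<noteq> 0 \<Longrightarrow> d e = poly p' e / poly q' e"
    using assms(1,2)[THEN regular_at_zeroE] by metis
  have "poly p' 0 \<noteq> 0" using *(3) *(4)[OF *(3)] assms(3) by auto
  then show ?thesis
    using * by (intro regular_at_zeroI[of "q * q' * p'" _ "p * q' * q'"]) (auto simp: u)
qed

text \<open>
Taking limits as \<open>e\<close> tends to 0 has no meaning over a general field.  The substitute is that a
polynomial which vanishes outside the zeros of a nonzero polynomial is zero, since the field is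
infinite.
\<close>

lemma regular_at_zero_eq_zero:
  fixes h :: "'a::field_char_0 \<Rightarrow> 'a"
  assumes "regular_at_zero h" "regular_at_zero d" "d 0 \<noteq> 0"
    and zero: "\<And>e. e \<noteq> 0 \<Longrightarrow> d e \<noteq> 0 \<Longrightarrow> h e = 0"
  shows "h 0 = 0"
proof -
  obtain p q p' q' where *: "poly q 0 \<noteq> 0" "\<And>e. poly q e \<noteq> 0 \<Longrightarrow> h e = poly p e / poly q e"
    "poly q' 0 \<noteq> 0" "\<And>e. poly q' e \<noteq> 0 \<Longrightarrow> d e = poly p' e / poly q' e"
    using assms(1,2)[THEN regular_at_zeroE] by metis
  have p': "poly p' 0 \<noteq> 0" using *(3) *(4)[OF *(3)] assms(3) by auto
  have "poly ([:0, 1:] * q * q' * p' * p) e = 0" for e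
  proof (cases "e = 0 \<or> poly q e = 0 \<or> poly q' e = 0 \<or> poly p' e = 0")
    case False
    then have "d e \<noteq> 0" using *(4)[of e] by simp
    then have "h e = 0" using zero False by blast
    then show ?thesis using *(2)[of e] False by simp
  qed auto
  then have "[:0, 1:] * q * q' * p' * p = 0" using poly_all_0_iff_0 by blast
  then have "p = 0" using *(1,3) p' by auto
  then show ?thesis using *(2)[OF *(1)] by simp
qed

section \<open>A slice for simultaneous conjugation\<close>

definition scale_matrix :: "'a::comm_ring_1 \<Rightarrow> 'a^'n^'n \<Rightarrow> 'a^'n^'n" where
  "scale_matrix e M = (\<chi> i j. e * M $ i $ j)"

lemma scale_matrix_zero [simp]: "scale_matrix 0 M = 0"
  by (simp add: scale_matrix_def vec_eq_iff)

lemma scale_matrix_mult_left: "scale_matrix e A ** B = scale_matrix e (A ** B)"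
  by (simp add: scale_matrix_def matrix_matrix_mult_def vec_eq_iff sum_distrib_left mult_ac)

lemma scale_matrix_mult_right: "A ** scale_matrix e B = scale_matrix e (A ** B)"
  by (simp add: scale_matrix_def matrix_matrix_mult_def vec_eq_iff sum_distrib_left mult_ac)

lemma scale_matrix_add: "scale_matrix e (A + B) = scale_matrix e A + scale_matrix e B"
  by (simp add: scale_matrix_def vec_eq_iff distrib_left)

lemma matrix_mult_add_left: "(A + B) ** C = A ** C + B ** C"
  for A B :: "'a::comm_ring_1^'n^'m"
  by (simp add: matrix_matrix_mult_def vec_eq_iff sum.distrib distrib_right)

lemma matrix_inv_both:
  assumes "invertible a"
  shows "a ** matrix_inv a = mat 1" "matrix_inv a ** a = mat 1"
  using assms someI_ex[of "\<lambda>b. a ** b = mat 1 \<and> b ** a = mat 1"]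
  unfolding invertible_def matrix_inv_def by auto

lemma conj_unique:
  fixes a :: "'a::field^'n^'n"
  assumes "invertible a" "a ** M = M' ** a"
  shows "a ** M ** matrix_inv a = M'"
  by (simp add: assms(2) matrix_mul_assoc[symmetric] matrix_inv_both(1)[OF assms(1)])

text \<open>
Cramer's rule, which shows that the inverse depends rationally on the matrix.
\<close>

lemma matrix_inv_entry:
  fixes a :: "'a::field^'n^'n"
  assumes "det a \<noteq> 0"
  shows "matrix_inv a $ k $ l =
    det (\<chi> i j. if j = k then (if i = l then 1 else 0) else a $ i $ j) / det a"
proof -
  have inv: "invertible a" using assms by (simp add: invertible_det_nz)
  have "a *v (\<chi> i. matrix_inv a $ i $ l) = (\<chi> i. if i = l then 1 else 0)"
    using matrix_inv_both(1)[OF inv]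
    by (simp add: matrix_vector_mult_def matrix_matrix_mult_def mat_def vec_eq_iff)
  then have "(\<chi> i. matrix_inv a $ i $ l) =
      (\<chi> k. det (\<chi> i j. if j = k then (\<chi> i. if i = l then 1 else 0) $ i else a $ i $ j) / det a)"
    using cramer[OF assms] by blast
  from arg_cong[OF this, of "\<lambda>v. v $ k"] show ?thesis by (simp only: vec_lambda_beta)
qed

lemma regular_at_zero_det:
  assumes "\<And>i j. regular_at_zero (\<lambda>e. M e $ i $ j)"
  shows "regular_at_zero (\<lambda>e. det (M e))"
  unfolding det_def
  by (intro regular_at_zero_sum regular_at_zero_mult regular_at_zero_const regular_at_zero_prod assms)

lemma regular_at_zero_matrix_mult:
  assumes "\<And>i j. regular_at_zero (\<lambda>e. M e $ i $ j)" "\<And>i j. regular_at_zero (\<lambda>e. M' e $ i $ j)"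
  shows "regular_at_zero (\<lambda>e. (M e ** M' e) $ i $ j)"
  by (simp add: matrix_matrix_mult_def regular_at_zero_sum regular_at_zero_mult assms)

lemma regular_at_zero_matrix_inv:
  assumes "\<And>i j. regular_at_zero (\<lambda>e. a e $ i $ j)" "det (a 0) \<noteq> 0"
  shows "regular_at_zero (\<lambda>e. matrix_inv (a e) $ k $ l)"
proof (rule regular_at_zero_quotient[OF _ regular_at_zero_det[of a]])
  show "regular_at_zero (\<lambda>e. det (\<chi> i j. if j = k then (if i = l then 1 else 0) else a e $ i $ j))"
    proof (rule regular_at_zero_det)
    show "regular_at_zero (\<lambda>e. (\<chi> i j. if j = k then (if i = l then 1 else 0) else a e $ i $ j) $ i $ j)" for i j
      by (cases "j = k"; cases "i = l") (simp_all add: assms(1))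
  qed
qed (use assms matrix_inv_entry in auto)

lemma regular_at_zero_polynomial_function:
  fixes f :: "('a::field, 'n::finite) mat_pair \<Rightarrow> 'a"
  assumes f: "f \<in> pair_polynomial_functions"
    and N: "\<And>i j. regular_at_zero (\<lambda>e. fst (N e) $ i $ j)" "\<And>i j. regular_at_zero (\<lambda>e. snd (N e) $ i $ j)"
  shows "regular_at_zero (\<lambda>e. f (N e))"
  using f unfolding pair_polynomial_functions_eq
proof induction
  case (gen g)
  then obtain c where "g = (\<lambda>z. coord_fun z c)" by (auto simp: coordinates_def)
  then show ?case
    by (cases c) (auto simp: coord_fun_def N split: prod.splits)
qed (auto intro: regular_at_zero_add regular_at_zero_mult)

definition line_point :: "('a::comm_ring_1, 'n::finite) mat_pair \<Rightarrow> ('a, 'n) mat_pair \<Rightarrow> 'a \<Rightarrow> ('a, 'n) mat_pair" where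
  "line_point z W e = (fst z + scale_matrix e (fst W), snd z + scale_matrix e (snd W))"

lemma coord_fun_line_point: "coord_fun (line_point z W e) c = coord_fun z c + e * coord_fun W c"
  by (cases c) (auto simp: coord_fun_def line_point_def scale_matrix_def split: prod.splits)

text \<open>
The Taylor expansion at \<open>z\<close>: the coefficient of \<open>e ^ k\<close> is the homogeneous part of degree \<open>k\<close> in
the direction \<open>W\<close>.
\<close>

lemma expansion_along_lines:
  fixes f :: "('a::field, 'n::finite) mat_pair \<Rightarrow> 'a"
  assumes "f \<in> pair_polynomial_functions"
  shows "\<exists>\<Gamma> m. (\<forall>W e. f (line_point z W e) = poly (\<Gamma> W) e) \<and>
    (\<forall>k. (\<lambda>W. coeff (\<Gamma> W) k) \<in> pair_polynomial_functions) \<and> (\<forall>W. degree (\<Gamma> W) \<le> m)"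
  using assms unfolding pair_polynomial_functions_eq
proof induction
  case (const c)
  show ?case
    by (intro exI[of _ "\<lambda>_. [:c:]"] exI[of _ 0]) (auto intro: subalgebra_gen.const)
next
  case (gen g)
  then obtain c where c: "g = (\<lambda>z. coord_fun z c)" by (auto simp: coordinates_def)
  have "(\<lambda>W. coeff [:coord_fun z c, coord_fun W c:] k) \<in> subalgebra_gen coordinates" for k
  proof (cases k)
    case (Suc j)
    then show ?thesis using subalgebra_gen.gen[OF gen] by (cases j) (auto simp: c intro: subalgebra_gen.const)
  qed (auto intro: subalgebra_gen.const)
  then show ?case
    by (intro exI[of _ "\<lambda>W. [:coord_fun z c, coord_fun W c:]"] exI[of _ 1])
       (auto simp: c coord_fun_line_point)
next
  case (add f g)
  then obtain \<Gamma> \<Delta> m n where "\<And>W e. f (line_point z W e) = poly (\<Gamma> W) e"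
    "\<And>k. (\<lambda>W. coeff (\<Gamma> W) k) \<in> subalgebra_gen coordinates" "\<And>W. degree (\<Gamma> W) \<le> m"
    "\<And>W e. g (line_point z W e) = poly (\<Delta> W) e"
    "\<And>k. (\<lambda>W. coeff (\<Delta> W) k) \<in> subalgebra_gen coordinates" "\<And>W. degree (\<Delta> W) \<le> n"
    by metis
  moreover from this have "degree (\<Gamma> W + \<Delta> W) \<le> max m n" for W
    by (intro degree_add_le max.coboundedI1 max.coboundedI2)
  ultimately show ?case
    by (intro exI[of _ "\<lambda>W. \<Gamma> W + \<Delta> W"] exI[of _ "max m n"])
       (auto intro!: subalgebra_gen.add)
next
  case (mult f g)
  then obtain \<Gamma> \<Delta> m n where *: "\<And>W e. f (line_point z W e) = poly (\<Gamma> W) e"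
    "\<And>k. (\<lambda>W. coeff (\<Gamma> W) k) \<in> subalgebra_gen coordinates" "\<And>W. degree (\<Gamma> W) \<le> m"
    "\<And>W e. g (line_point z W e) = poly (\<Delta> W) e"
    "\<And>k. (\<lambda>W. coeff (\<Delta> W) k) \<in> subalgebra_gen coordinates" "\<And>W. degree (\<Delta> W) \<le> n"
    by metis
  have "degree (\<Gamma> W * \<Delta> W) \<le> m + n" for W
    using degree_mult_le[of "\<Gamma> W" "\<Delta> W"] *(3)[of W] *(6)[of W] by linarith
  moreover have "(\<lambda>W. coeff (\<Gamma> W * \<Delta> W) k) \<in> subalgebra_gen coordinates" for k
    unfolding coeff_mult by (intro subalgebra_gen_sum subalgebra_gen.mult *)
  ultimately show ?case
    using *(1,4) by (intro exI[of _ "\<lambda>W. \<Gamma> W * \<Delta> W"] exI[of _ "m + n"]) auto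
qed

definition slice_pairs :: "'n \<Rightarrow> ('a::field, 'n::finite) mat_pair set" where
  "slice_pairs i0 = {z. (\<forall>i j. i \<noteq> j \<longrightarrow> fst z $ i $ j = 0) \<and> (\<forall>j. j \<noteq> i0 \<longrightarrow> snd z $ i0 $ j = 1)}"

text \<open>
The tangent space of the slice at \<open>(X, Y)\<close> and the tangent space of the orbit, which consists of
the pairs of commutators with \<open>(X, Y)\<close>, span everything.  The entry \<open>(i, j)\<close> of the commutator with
the diagonal matrix \<open>X\<close> is \<open>A i j * (d j - d i)\<close>, which determines \<open>A\<close> off the diagonal.  In row \<open>i0\<close>
and column \<open>j\<close> the commutator with \<open>Y\<close> is \<open>A i0 i0\<close> minus the sum of column \<open>j\<close> of \<open>A\<close>, which
determines the diagonal of \<open>A\<close> once \<open>A i0 i0 = 0\<close> is chosen.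
\<close>

lemma slice_transversal:
  fixes Z W :: "'a::field^'n::finite^'n" and d :: "'n \<Rightarrow> 'a" and i0 :: 'n
  assumes "inj d"
  defines "X \<equiv> \<chi> i j. if i = j then d i else 0" and "Y \<equiv> \<chi> i j. if i = i0 then 1 else 0"
  shows "\<exists>A E F. (\<forall>i j. i \<noteq> j \<longrightarrow> E $ i $ j = 0) \<and> (\<forall>j. j \<noteq> i0 \<longrightarrow> F $ i0 $ j = 0) \<and>
    A ** X - X ** A + E = Z \<and> A ** Y - Y ** A + F = W"
proof -
  define A0 :: "'a^'n^'n" where "A0 = (\<chi> i j. if i = j then 0 else Z $ i $ j / (d j - d i))"
  define A' :: "'a^'n^'n" where "A' = (\<chi> i j. if i \<noteq> j then A0 $ i $ j else if i = i0 then 0 else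
      - (\<Sum>k\<in>UNIV. A0 $ k $ i) - W $ i0 $ i)"
  define E where "E = Z - (A' ** X - X ** A')"
  define F where "F = W - (A' ** Y - Y ** A')"
  have AX: "(A' ** X) $ i $ j = A' $ i $ j * d j" for i j
    unfolding matrix_matrix_mult_def X_def by (simp add: if_distrib sum.delta cong: if_cong)
  have XA: "(X ** A') $ i $ j = d i * A' $ i $ j" for i j
    unfolding matrix_matrix_mult_def X_def by (simp add: if_distribR sum.delta' if_distrib cong: if_cong)
  have AY: "(A' ** Y) $ i $ j = A' $ i $ i0" for i j
    unfolding matrix_matrix_mult_def Y_def by (simp add: if_distrib sum.delta cong: if_cong)
  have YA: "(Y ** A') $ i0 $ j = (\<Sum>k\<in>UNIV. A' $ k $ j)" for j
    unfolding matrix_matrix_mult_def Y_def by simp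
  have "E $ i $ j = 0" if "i \<noteq> j" for i j
  proof -
    have "d j - d i \<noteq> 0" using that assms(1) by (auto simp: inj_def)
    moreover have "A' $ i $ j = Z $ i $ j / (d j - d i)" using that by (simp add: A'_def A0_def)
    ultimately have "A' $ i $ j * (d j - d i) = Z $ i $ j" by simp
    then show ?thesis by (simp add: E_def AX XA algebra_simps)
  qed
  moreover have "F $ i0 $ j = 0" if "j \<noteq> i0" for j
  proof -
    have "(\<Sum>k\<in>UNIV. A' $ k $ j) = A' $ j $ j + (\<Sum>k\<in>UNIV - {j}. A' $ k $ j)"
      by (simp add: sum.remove)
    also have "(\<Sum>k\<in>UNIV - {j}. A' $ k $ j) = (\<Sum>k\<in>UNIV - {j}. A0 $ k $ j)"
      by (intro sum.cong) (auto simp: A'_def)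
    also have "\<dots> = (\<Sum>k\<in>UNIV. A0 $ k $ j)"
      by (subst (2) sum.remove[of _ j]) (auto simp: A0_def)
    finally have "(\<Sum>k\<in>UNIV. A' $ k $ j) = - W $ i0 $ j"
      using that by (simp add: A'_def)
    moreover have "A' $ i0 $ i0 = 0" by (simp add: A'_def)
    ultimately show ?thesis by (simp add: F_def AY YA)
  qed
  moreover have "A' ** X - X ** A' + E = Z" "A' ** Y - Y ** A' + F = W"
    by (simp_all add: E_def F_def)
  ultimately show ?thesis by blast
qed

text \<open>
The velocity at \<open>e = 0\<close> of the conjugated line is the commutator with \<open>M\<close> plus \<open>E\<close>.  The identity
is exact, so it also shows that the correction to the line through \<open>M\<close> is regular at 0.
\<close>

lemma conj_curve:
  fixes A M E :: "'a::field^'n::finite^'n"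
  defines "a \<equiv> \<lambda>e. mat 1 + scale_matrix e A"
  assumes "invertible (a e)"
  shows "a e ** (M + scale_matrix e E) ** matrix_inv (a e) =
    M + scale_matrix e ((A ** M - M ** A + E + scale_matrix e (A ** E)) ** matrix_inv (a e))"
    (is "_ = M + scale_matrix e (?K ** _)")
proof -
  have "a e ** (M + scale_matrix e E) = M ** a e + scale_matrix e ?K"
  proof -
    have 1: "a e ** (M + scale_matrix e E) =
        M + scale_matrix e (A ** M) + (scale_matrix e E + scale_matrix e (scale_matrix e (A ** E)))"
      by (simp add: a_def matrix_mult_add_left matrix_add_ldistrib scale_matrix_mult_left
          scale_matrix_mult_right scale_matrix_add add_ac)
    have 2: "M ** a e = M + scale_matrix e (M ** A)"
      by (simp add: a_def matrix_add_ldistrib scale_matrix_mult_right)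
    have "M + scale_matrix e P + (scale_matrix e E + scale_matrix e Q) =
        M + scale_matrix e P' + scale_matrix e (P - P' + E + Q)" for P P' Q :: "'a^'n^'n"
      by (simp add: scale_matrix_def vec_eq_iff algebra_simps)
    then show ?thesis unfolding 1 2 .
  qed
  then show ?thesis
    by (simp add: matrix_mult_add_left matrix_mul_assoc[symmetric] scale_matrix_mult_left matrix_inv_both(1)[OF assms(2)])
qed

text \<open>
Suppose that \<open>f\<close> is not zero, and let \<open>k\<close> be the lowest degree in its Taylor expansion at a point of
the slice.  By transversality every direction \<open>Z\<close> is the velocity of a curve of conjugates of points
of the slice, on which \<open>f\<close> vanishes.  The lowest term of \<open>f\<close> along this curve is \<open>e ^ k\<close> times the
value at \<open>Z\<close> of the homogeneous part of degree \<open>k\<close>.  Hence this part vanishes at every \<open>Z\<close>, against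
the choice of \<open>k\<close>.
\<close>

theorem invariant_zero_if_zero_on_slice:
  fixes f :: "('a::field_char_0, 'n::finite) mat_pair \<Rightarrow> 'a"
  assumes f: "f \<in> pair_invariants" and slice: "\<And>z. z \<in> slice_pairs i0 \<Longrightarrow> f z = 0"
  shows "f z = 0"
proof (rule ccontr)
  assume nz: "f z \<noteq> 0"
  obtain h :: "'n \<Rightarrow> nat" where h: "inj h"
    using finite_imp_inj_to_nat_seg[of "UNIV :: 'n set"] by auto
  define d :: "'n \<Rightarrow> 'a" where "d = (\<lambda>i. of_nat (h i))"
  have d: "inj d" using h by (auto simp: d_def inj_def)
  define X :: "'a^'n^'n" where "X = (\<chi> i j. if i = j then d i else 0)"
  define Y :: "'a^'n^'n" where "Y = (\<chi> i j. if i = i0 then 1 else 0)"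
  have poly_f: "f \<in> pair_polynomial_functions" using f by (simp add: pair_invariants_def)
  have invariant: "f (simultaneous_conj a z) = f z" if "invertible a" for a z
    using f that unfolding pair_invariants_def by blast
  obtain \<Gamma> m where \<Gamma>: "\<And>W e. f (line_point (X, Y) W e) = poly (\<Gamma> W) e"
    "\<And>k. (\<lambda>W. coeff (\<Gamma> W) k) \<in> pair_polynomial_functions" "\<And>W. degree (\<Gamma> W) \<le> m"
    using expansion_along_lines[OF poly_f, of "(X, Y)"] by blast
  define nonzero where "nonzero = (\<lambda>k. \<exists>W. coeff (\<Gamma> W) k \<noteq> 0)"
  have "line_point (X, Y) (fst z - X, snd z - Y) 1 = z"
    by (simp add: line_point_def scale_matrix_def vec_eq_iff prod_eq_iff)
  then have "\<Gamma> (fst z - X, snd z - Y) \<noteq> 0" using nz \<Gamma>(1)[of "(fst z - X, snd z - Y)" 1] by auto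
  then have "lead_coeff (\<Gamma> (fst z - X, snd z - Y)) \<noteq> 0" by simp
  then have ex: "\<exists>k. nonzero k" unfolding nonzero_def by blast
  define k where "k = (LEAST k. nonzero k)"
  have k: "nonzero k" "\<And>j. j < k \<Longrightarrow> \<not> nonzero j"
    unfolding k_def using LeastI_ex[OF ex] not_less_Least by auto
  then obtain Z where Z: "coeff (\<Gamma> Z) k \<noteq> 0" by (auto simp: nonzero_def)
  obtain A E F where AEF: "\<And>i j. i \<noteq> j \<Longrightarrow> E $ i $ j = 0" "\<And>j. j \<noteq> i0 \<Longrightarrow> F $ i0 $ j = 0"
    "A ** X - X ** A + E = fst Z" "A ** Y - Y ** A + F = snd Z"
    using slice_transversal[OF d, of i0 "fst Z" "snd Z", folded X_def Y_def]
    by (elim exE conjE) (rule that; simp)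
  define a where "a = (\<lambda>e. mat 1 + scale_matrix e A)"
  \<comment> \<open>The conjugate by \<open>a e\<close> of the point of the slice with parameter \<open>e\<close> is \<open>(X, Y) + e * N e\<close>.\<close>
  define N where "N = (\<lambda>e. ((A ** X - X ** A + E + scale_matrix e (A ** E)) ** matrix_inv (a e),
                            (A ** Y - Y ** A + F + scale_matrix e (A ** F)) ** matrix_inv (a e)))"
  have a0: "a 0 = mat 1" by (simp add: a_def)
  have "invertible (a 0)" by (simp add: a0 invertible_det_nz)
  then have "matrix_inv (a 0) = mat 1" using matrix_inv_both(1)[of "a 0"] by (simp add: a0)
  then have N0: "N 0 = Z"
    by (simp add: N_def AEF(3,4))
  have reg_lin: "regular_at_zero (\<lambda>e. (M + scale_matrix e M') $ i $ j)" for M M' :: "'a^'n^'n" and i j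
    unfolding scale_matrix_def vector_add_component vec_lambda_beta
    by (intro regular_at_zero_add regular_at_zero_mult regular_at_zero_const regular_at_zero_ident)
  have reg_a: "regular_at_zero (\<lambda>e. a e $ i $ j)" for i j
    unfolding a_def by (rule reg_lin)
  have reg_inv: "regular_at_zero (\<lambda>e. matrix_inv (a e) $ i $ j)" for i j
    by (rule regular_at_zero_matrix_inv[OF reg_a]) (simp add: a0)
  have reg_N: "regular_at_zero (\<lambda>e. fst (N e) $ i $ j)" "regular_at_zero (\<lambda>e. snd (N e) $ i $ j)" for i j
    unfolding N_def fst_conv snd_conv by (intro regular_at_zero_matrix_mult reg_lin reg_inv)+
  \<comment> \<open>The restriction of \<open>f\<close> to the curve, divided by \<open>e ^ k\<close>.\<close>
  define H where "H = (\<lambda>e. \<Sum>j\<in>{k..m}. coeff (\<Gamma> (N e)) j * e ^ (j - k))"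
  have reg_H: "regular_at_zero H"
    unfolding H_def
    by (intro regular_at_zero_sum regular_at_zero_mult regular_at_zero_power regular_at_zero_ident
        regular_at_zero_polynomial_function[OF \<Gamma>(2)] reg_N)
  have "H 0 = 0"
  proof (rule regular_at_zero_eq_zero[OF reg_H regular_at_zero_det[OF reg_a]])
    fix e :: 'a assume e: "e \<noteq> 0" "det (a e) \<noteq> 0"
    then have inv: "invertible (a e)" by (simp add: invertible_det_nz)
    have "line_point (X, Y) (N e) e = simultaneous_conj (a e) (line_point (X, Y) (E, F) e)"
      using inv conj_curve[of e A X E] conj_curve[of e A Y F]
      by (simp add: line_point_def N_def simultaneous_conj_def a_def)
    moreover have "line_point (X, Y) (E, F) e \<in> slice_pairs i0"
      by (simp add: slice_pairs_def line_point_def scale_matrix_def AEF(1,2) X_def Y_def)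
    ultimately have "f (line_point (X, Y) (N e) e) = 0"
      using invariant[OF inv] slice by metis
    then have "poly (\<Gamma> (N e)) e = 0" unfolding \<Gamma>(1) .
    also have "poly (\<Gamma> (N e)) e = (\<Sum>j\<le>m. coeff (\<Gamma> (N e)) j * e ^ j)"
      unfolding poly_altdef using \<Gamma>(3)[of "N e"]
      by (intro sum.mono_neutral_left) (auto simp: coeff_eq_0 not_le)
    also have "\<dots> = (\<Sum>j\<in>{k..m}. coeff (\<Gamma> (N e)) j * e ^ j)"
    proof (rule sum.mono_neutral_right)
      show "\<forall>j\<in>{..m} - {k..m}. coeff (\<Gamma> (N e)) j * e ^ j = 0"
      proof
        fix j assume "j \<in> {..m} - {k..m}"
        then have "\<not> nonzero j" using k(2) by auto
        then have "coeff (\<Gamma> (N e)) j = 0" unfolding nonzero_def by blast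
        then show "coeff (\<Gamma> (N e)) j * e ^ j = 0" by simp
      qed
    qed auto
    also have "\<dots> = e ^ k * H e"
      unfolding H_def sum_distrib_left
    proof (rule sum.cong)
      fix j assume "j \<in> {k..m}"
      then have "e ^ j = e ^ k * e ^ (j - k)" by (simp flip: power_add)
      then show "coeff (\<Gamma> (N e)) j * e ^ j = e ^ k * (coeff (\<Gamma> (N e)) j * e ^ (j - k))" by simp
    qed simp
    finally show "H e = 0" using e by simp
  qed (simp add: a0)
  have km: "k \<le> m"
    using Z \<Gamma>(3)[of Z] le_degree[of "\<Gamma> Z" k] by (meson order.trans)
  have "H 0 = coeff (\<Gamma> Z) k * 0 ^ (k - k) + (\<Sum>j\<in>{k..m} - {k}. coeff (\<Gamma> Z) j * 0 ^ (j - k))"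
    unfolding H_def N0 by (rule sum.remove) (use km in auto)
  also have "(\<Sum>j\<in>{k..m} - {k}. coeff (\<Gamma> Z) j * 0 ^ (j - k)) = 0"
    by (rule sum.neutral) auto
  finally have "H 0 = coeff (\<Gamma> Z) k" by simp
  then show False using Z \<open>H 0 = 0\<close> by simp
qed

section \<open>The upper bound for the number of parameters\<close>

text \<open>
A linear relation between monomials is a polynomial relation: distinct exponent vectors give
distinct formal monomials, so their coefficients can be read off.
\<close>

lemma independent_family_if_algebraically_independent:
  fixes S :: "('z \<Rightarrow> 'a::comm_ring_1) set"
  assumes S: "finite S" and indep: "algebraically_independent S"
  shows "independent_family S (\<lambda>P. P)"
  unfolding independent_family_def
proof (intro allI impI ballI)
  fix D :: nat and c :: "(('z \<Rightarrow> 'a) \<Rightarrow> nat) \<Rightarrow> 'a" and m0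
  let ?box = "S \<rightarrow>\<^sub>E {..<D}"
  assume rel: "\<forall>z. (\<Sum>m\<in>?box. c m * (\<Prod>P\<in>S. P z ^ m P)) = 0" and m0: "m0 \<in> ?box"
  define \<mu> where "\<mu> = (\<lambda>m. \<Sum>P\<in>S. Poly_Mapping.single P (m P :: nat))"
  have lookup_\<mu>: "Poly_Mapping.lookup (\<mu> m) P = (if P \<in> S then m P else 0)" for m P
    using S by (simp add: \<mu>_def lookup_sum lookup_single when_def sum.delta)
  have keys_\<mu>: "Poly_Mapping.keys (\<mu> m) \<subseteq> S" for m
    by (auto simp: in_keys_iff lookup_\<mu> split: if_splits)
  have inj: "m = m'" if "\<mu> m = \<mu> m'" "m \<in> ?box" "m' \<in> ?box" for m m'
  proof (rule PiE_ext[OF that(2,3)])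
    fix P assume "P \<in> S"
    then show "m P = m' P" using lookup_\<mu>[of m P] lookup_\<mu>[of m' P] that(1) by simp
  qed
  have fin: "finite ?box" using S by (simp add: finite_PiE)
  define p where "p = (\<Sum>m\<in>?box. Poly_Mapping.single (\<mu> m) (c m))"
  have "(\<Prod>P\<in>Poly_Mapping.keys (\<mu> m). P z ^ Poly_Mapping.lookup (\<mu> m) P) = (\<Prod>P\<in>S. P z ^ m P)" for m z
    unfolding monomial_eval_superset[OF S keys_\<mu>] by (simp add: lookup_\<mu>)
  then have "mpoly_eval (\<lambda>P. P z) p = 0" for z
    using rel by (simp add: p_def mpoly_eval_sum mpoly_eval_single)
  then have "mpoly_subst p = (\<lambda>_. 0)" by (auto simp: mpoly_subst_def)
  moreover have "mpoly_vars p \<subseteq> S"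
  proof -
    have "Poly_Mapping.keys p \<subseteq> \<mu> ` ?box"
      unfolding p_def using keys_sum[of "\<lambda>m. Poly_Mapping.single (\<mu> m) (c m)" ?box]
      by (auto split: if_splits)
    then show ?thesis using keys_\<mu> by (fastforce simp: mpoly_vars_def)
  qed
  ultimately have "p = 0" using indep by (auto simp: algebraically_independent_def)
  moreover have "Poly_Mapping.lookup p (\<mu> m0) = (\<Sum>m\<in>?box. if m = m0 then c m else 0)"
    unfolding p_def lookup_sum
    by (intro sum.cong) (auto simp: lookup_single when_def dest: inj[OF _ _ m0])
  ultimately show "c m0 = 0" using fin m0 by (simp add: sum.delta)
qed

lemma pair_invariants_iff:
  "f \<in> pair_invariants \<longleftrightarrow> f \<in> subalgebra_gen coordinates \<and>
     (\<forall>a z. invertible a \<longrightarrow> f (simultaneous_conj a z) = f z)"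
  by (simp add: pair_invariants_def pair_polynomial_functions_eq)

lemma pair_invariants_const: "(\<lambda>_. c) \<in> pair_invariants"
  by (auto simp: pair_invariants_iff intro: subalgebra_gen.const)

lemma pair_invariants_add:
  "f \<in> pair_invariants \<Longrightarrow> g \<in> pair_invariants \<Longrightarrow> (\<lambda>z. f z + g z) \<in> pair_invariants"
  by (auto simp: pair_invariants_iff intro: subalgebra_gen.add)

lemma pair_invariants_mult:
  "f \<in> pair_invariants \<Longrightarrow> g \<in> pair_invariants \<Longrightarrow> (\<lambda>z. f z * g z) \<in> pair_invariants"
  by (auto simp: pair_invariants_iff intro: subalgebra_gen.mult)

lemma pair_invariants_sum:
  "(\<And>i. i \<in> I \<Longrightarrow> f i \<in> pair_invariants) \<Longrightarrow> (\<lambda>z. \<Sum>i\<in>I. f i z) \<in> pair_invariants"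
  by (induction I rule: infinite_finite_induct) (auto intro: pair_invariants_const pair_invariants_add)

lemma pair_invariants_prod:
  "(\<And>i. i \<in> I \<Longrightarrow> f i \<in> pair_invariants) \<Longrightarrow> (\<lambda>z. \<Prod>i\<in>I. f i z) \<in> pair_invariants"
  by (induction I rule: infinite_finite_induct) (auto intro: pair_invariants_const pair_invariants_mult)

lemma pair_invariants_power: "f \<in> pair_invariants \<Longrightarrow> (\<lambda>z. f z ^ k) \<in> pair_invariants"
  by (induction k) (auto intro: pair_invariants_const pair_invariants_mult)

text \<open>
The argument has one value for every coordinate on pairs, but only the coordinates that are free on
the slice enter.
\<close>

definition slice_point :: "'n \<Rightarrow> ('n coord \<Rightarrow> 'a) \<Rightarrow> ('a::field, 'n::finite) mat_pair" where
  "slice_point i0 \<tau> = (\<chi> i j. if i = j then \<tau> (Inl (i, i)) else 0,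
     \<chi> i j. if i = i0 \<and> j \<noteq> i0 then 1 else \<tau> (Inr (i, j)))"

definition slice_coords :: "'n \<Rightarrow> 'n::finite coord set" where
  "slice_coords i0 = (\<lambda>i. Inl (i, i)) ` UNIV \<union> Inr ` (UNIV - {i0} \<times> (UNIV - {i0}))"

text \<open>
There are \<open>n\<close> diagonal entries in the first matrix and \<open>n * n - (n - 1)\<close> free entries in the second.
\<close>

lemma card_slice_coords: "card (slice_coords (i0 :: 'n::finite)) = CARD('n) ^ 2 + 1"
proof -
  have n: "CARD('n) \<ge> 1" by (simp add: Suc_leI)
  have "card (slice_coords i0) =
      card ((\<lambda>i::'n. Inl (i, i) :: 'n coord) ` UNIV) + card ((Inr :: _ \<Rightarrow> 'n coord) ` (UNIV - {i0} \<times> (UNIV - {i0})))"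
    unfolding slice_coords_def by (rule card_Un_disjoint) auto
  also have "card ((\<lambda>i::'n. Inl (i, i) :: 'n coord) ` UNIV) = CARD('n)"
    by (rule card_image) (auto simp: inj_def)
  also have "card ((Inr :: _ \<Rightarrow> 'n coord) ` (UNIV - {i0} \<times> (UNIV - {i0}))) = card (UNIV - {i0} \<times> (UNIV - {i0}))"
    by (rule card_image) auto
  also have "\<dots> = CARD('n \<times> 'n) - card ({i0} \<times> (UNIV - {i0}))"
    by (rule card_Diff_subset) auto
  also have "\<dots> = CARD('n) * CARD('n) - (CARD('n) - 1)"
    by (simp add: card_cartesian_product card_Diff_singleton)
  finally show ?thesis using n mult_le_mono[OF n order_refl[of "CARD('n)"]]
    by (simp add: power2_eq_square)
qed

lemma slice_pairs_subset_range: "slice_pairs i0 \<subseteq> range (slice_point i0)"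
proof
  fix z assume z: "z \<in> slice_pairs i0"
  have "slice_point i0 (coord_fun z) = z"
    using z by (auto simp: slice_point_def slice_pairs_def coord_fun_def prod_eq_iff vec_eq_iff)
  then show "z \<in> range (slice_point i0)" by (metis rangeI)
qed

text \<open>
A relation between the restrictions to the slice is a relation between the invariants, since the
relation evaluated at the invariants is itself an invariant.  So the restrictions are independent,
and they lie in the polynomial algebra on the coordinates of the slice, regarded as a module
generated by 1 over itself.
\<close>

theorem card_system_of_parameters_le:
  fixes S :: "(('a::field_char_0, 'n::finite) mat_pair \<Rightarrow> 'a) set"
  assumes S: "finite S" "S \<subseteq> pair_invariants" "algebraically_independent S"
  shows "card S \<le> CARD('n) ^ 2 + 1"
proof -
  obtain i0 :: 'n where True by simp
  have indep: "independent_family S (\<lambda>P \<tau>. P (slice_point i0 \<tau>))"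
    unfolding independent_family_def
  proof (intro allI impI)
    fix D :: nat and c :: "((('a, 'n) mat_pair \<Rightarrow> 'a) \<Rightarrow> nat) \<Rightarrow> 'a"
    assume rel: "\<forall>\<tau>. (\<Sum>m\<in>S \<rightarrow>\<^sub>E {..<D}. c m * (\<Prod>P\<in>S. P (slice_point i0 \<tau>) ^ m P)) = 0"
    let ?F = "\<lambda>z. \<Sum>m\<in>S \<rightarrow>\<^sub>E {..<D}. c m * (\<Prod>P\<in>S. P z ^ m P)"
    have F: "?F \<in> pair_invariants"
      using S(2) by (intro pair_invariants_sum pair_invariants_mult pair_invariants_const
          pair_invariants_prod pair_invariants_power) auto
    have "?F z = 0" for z
      by (rule invariant_zero_if_zero_on_slice[OF F])
         (use slice_pairs_subset_range[of i0] rel in auto)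
    then show "\<forall>m\<in>S \<rightarrow>\<^sub>E {..<D}. c m = 0"
      using independent_family_if_algebraically_independent[OF S(1,3)]
      unfolding independent_family_def by blast
  qed
  let ?R = "subalgebra_gen ((\<lambda>j (\<tau> :: 'n coord \<Rightarrow> 'a). \<tau> j) ` slice_coords i0)"
  have in_R: "f \<in> module_span ?R {\<lambda>_. 1}" if "f \<in> ?R" for f
    unfolding module_span_def using that by (auto intro!: exI[of _ "\<lambda>_. f"])
  have "(\<lambda>\<tau>. P (slice_point i0 \<tau>)) \<in> ?R" if "P \<in> S" for P
  proof (rule subalgebra_gen_comp[where f = P and \<phi> = "slice_point i0"])
    show "P \<in> subalgebra_gen coordinates" using that S(2) by (auto simp: pair_invariants_iff)
    fix g :: "('a, 'n) mat_pair \<Rightarrow> 'a" assume "g \<in> coordinates"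
    then obtain c where g: "g = (\<lambda>z. coord_fun z c)" by (auto simp: coordinates_def)
    have coord: "(\<lambda>\<tau>. \<tau> c) \<in> ?R" if "c \<in> slice_coords i0"
      by (rule subalgebra_gen.gen) (use that in auto)
    show "(\<lambda>\<tau>. g (slice_point i0 \<tau>)) \<in> ?R"
    proof (cases c)
      case (Inl ij)
      then show ?thesis using coord
        by (cases ij; cases "fst ij = snd ij")
           (auto simp: g coord_fun_def slice_point_def slice_coords_def intro: subalgebra_gen.const)
    next
      case (Inr ij)
      then show ?thesis using coord
        by (cases ij; cases "fst ij = i0 \<and> snd ij \<noteq> i0")
           (auto simp: g coord_fun_def slice_point_def slice_coords_def intro: subalgebra_gen.const)
    qed
  qed
  note polys = this
  have "card S \<le> card (slice_coords i0)"
  proof (rule independent_family_card_le[where g = "\<lambda>j \<tau>. \<tau> j" and B = "{\<lambda>_. 1}", OF S(1) _ _ indep])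
    show "(\<lambda>_. 1) \<in> module_span ?R {\<lambda>_. 1}" by (intro in_R subalgebra_gen.const)
    fix P :: "('a, 'n) mat_pair \<Rightarrow> 'a" and b :: "('n coord \<Rightarrow> 'a) \<Rightarrow> 'a"
    assume "P \<in> S" "b \<in> {\<lambda>_. 1}"
    then show "(\<lambda>\<tau>. P (slice_point i0 \<tau>) * b \<tau>) \<in> module_span ?R {\<lambda>_. 1}"
      using in_R polys by simp
  qed auto
  then show ?thesis by (simp add: card_slice_coords)
qed

section \<open>Invariants from words\<close>

text \<open>
The letters are multiplied from the left, so that letter 0 acts first on column vectors.
\<close>

primrec word_matrix :: "(nat \<Rightarrow> bool) \<Rightarrow> ('a::comm_ring_1, 'n::finite) mat_pair \<Rightarrow> nat \<Rightarrow> 'a^'n^'n" where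
  "word_matrix w z 0 = mat 1"
| "word_matrix w z (Suc k) = (if w k then fst z else snd z) ** word_matrix w z k"

lemma word_matrix_conj:
  fixes z :: "('a::field, 'n::finite) mat_pair"
  assumes "invertible a"
  shows "word_matrix w (simultaneous_conj a z) k = a ** word_matrix w z k ** matrix_inv a"
proof (induction k)
  case 0
  then show ?case using matrix_inv_both(1)[OF assms] by simp
next
  case (Suc k)
  have cancel: "(a ** M ** matrix_inv a) ** (a ** N ** matrix_inv a) = a ** (M ** N) ** matrix_inv a"
    for M N :: "'a^'n^'n"
  proof -
    have "(a ** M ** matrix_inv a) ** (a ** N ** matrix_inv a) =
        a ** M ** (matrix_inv a ** a) ** N ** matrix_inv a" by (simp only: matrix_mul_assoc)
    then show ?thesis by (simp add: matrix_inv_both(2)[OF assms] matrix_mul_assoc)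
  qed
  have "fst (simultaneous_conj a z) = a ** fst z ** matrix_inv a"
    "snd (simultaneous_conj a z) = a ** snd z ** matrix_inv a"
    by (simp_all add: simultaneous_conj_def)
  then show ?case by (simp add: Suc cancel)
qed

lemma subalgebra_gen_matrix_mult:
  assumes "\<And>i j. (\<lambda>z. M z $ i $ j) \<in> subalgebra_gen G" "\<And>i j. (\<lambda>z. M' z $ i $ j) \<in> subalgebra_gen G"
  shows "(\<lambda>z. (M z ** M' z) $ i $ j) \<in> subalgebra_gen G"
  unfolding matrix_matrix_mult_def vec_lambda_beta
  by (intro subalgebra_gen_sum subalgebra_gen.mult assms)

lemma word_matrix_entry_polynomial:
  "(\<lambda>z. word_matrix w z k $ i $ j) \<in> subalgebra_gen (coordinates :: (('a::field, 'n::finite) mat_pair \<Rightarrow> 'a) set)"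
proof (induction k arbitrary: i j)
  case 0
  then show ?case by (simp add: subalgebra_gen.const)
next
  case (Suc k)
  have x: "(\<lambda>z. fst z $ i $ j) \<in> subalgebra_gen (coordinates :: (('a, 'n) mat_pair \<Rightarrow> 'a) set)" for i j
    by (rule subalgebra_gen.gen) (auto simp: coordinates_def coord_fun_def intro!: image_eqI[of _ _ "Inl (i, j)"])
  have y: "(\<lambda>z. snd z $ i $ j) \<in> subalgebra_gen (coordinates :: (('a, 'n) mat_pair \<Rightarrow> 'a) set)" for i j
    by (rule subalgebra_gen.gen) (auto simp: coordinates_def coord_fun_def intro!: image_eqI[of _ _ "Inr (i, j)"])
  show ?case
    by (cases "w k") (simp_all add: subalgebra_gen_matrix_mult x y Suc)
qed

lemma det_word_matrix_invariant:
  "(\<lambda>z. det (mat c - word_matrix w z k)) \<in> (pair_invariants :: (('a::field, 'n::finite) mat_pair \<Rightarrow> 'a) set)"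
  unfolding pair_invariants_iff
proof (intro conjI allI impI)
  show "(\<lambda>z. det (mat c - word_matrix w z k)) \<in> subalgebra_gen (coordinates :: (('a, 'n) mat_pair \<Rightarrow> 'a) set)"
    unfolding det_def vector_minus_component
    by (intro subalgebra_gen_sum subalgebra_gen.mult subalgebra_gen.const subalgebra_gen_prod
        subalgebra_gen_diff word_matrix_entry_polynomial)
  fix a :: "'a^'n^'n" and z :: "('a, 'n) mat_pair" assume a: "invertible a"
  let ?W = "word_matrix w z k"
  have comm: "a ** mat c = mat c ** a"
    unfolding matrix_matrix_mult_def mat_def vec_eq_iff
    by (simp add: if_distrib if_distribR sum.delta sum.delta' mult.commute cong: if_cong)
  have "mat c ** a - (a ** ?W ** matrix_inv a) ** a = a ** (mat c - ?W)"
    by (simp add: matrix_mul_assoc[symmetric] matrix_inv_both(2)[OF a] comm[symmetric])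
       (simp add: matrix_matrix_mult_def vec_eq_iff sum_subtractf right_diff_distrib)
  then have "(mat c - a ** ?W ** matrix_inv a) ** a = a ** (mat c - ?W)"
    by (simp add: matrix_matrix_mult_def vec_eq_iff sum_subtractf left_diff_distrib)
  then have "det (mat c - a ** ?W ** matrix_inv a) * det a = det a * det (mat c - ?W)"
    by (metis det_mul)
  moreover have "det a \<noteq> 0" using a by (simp add: invertible_det_nz)
  ultimately show "det (mat c - word_matrix w (simultaneous_conj a z) k) = det (mat c - ?W)"
    by (simp add: word_matrix_conj[OF a])
qed

section \<open>Cyclic words on a ladder\<close>

text \<open>
The function \<open>h\<close> assigns levels to the basis vectors.  The same weight \<open>\<zeta> i\<close> is used for the edge of
the first matrix that starts at level \<open>i\<close> and for the edge of the second that ends there.  The weights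
of the cycles remain independent under this identification, also when \<open>a\<close> or \<open>b\<close> is 0 and
only one of the matrices occurs in the cycle.
\<close>

definition ladder_pair :: "('n \<Rightarrow> nat) \<Rightarrow> nat \<Rightarrow> nat \<Rightarrow> (nat \<Rightarrow> 'a::comm_ring_1) \<Rightarrow> ('a, 'n::finite) mat_pair" where
  "ladder_pair h a b \<zeta> = (\<chi> p q. if h p = h q + b then \<zeta> (h q) else 0,
                         \<chi> p q. if h p + a = h q then \<zeta> (h p) else 0)"

text \<open>
The level, relative to the bottom of a window of \<open>a + b\<close> levels, that is reached after \<open>l\<close> steps of
the cycle through the window.  Going up by \<open>b\<close> or down by \<open>a\<close> is the same modulo \<open>a + b\<close>, and just
one of the two moves stays in the window.
\<close>

definition cycle_position :: "nat \<Rightarrow> nat \<Rightarrow> nat \<Rightarrow> nat" where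
  "cycle_position a b l = l * b mod (a + b)"

definition cycle_word :: "nat \<Rightarrow> nat \<Rightarrow> nat \<Rightarrow> bool" where
  "cycle_word a b l \<longleftrightarrow> cycle_position a b l < a"

text \<open>
The index of the weight on the edge that leaves the relative level \<open>c\<close>: its start for a step up,
its end for a step down.
\<close>

definition step_index :: "nat \<Rightarrow> nat \<Rightarrow> nat" where
  "step_index a c = (if c < a then c else c - a)"

definition cycle_weight :: "nat \<Rightarrow> nat \<Rightarrow> nat \<Rightarrow> (nat \<Rightarrow> 'a::comm_ring_1) \<Rightarrow> 'a" where
  "cycle_weight a b i \<zeta> = (\<Prod>c<a + b. \<zeta> (i + step_index a c))"

lemma cycle_position_Suc:
  assumes "a + b > 0"
  shows "cycle_position a b (Suc l) =
    (if cycle_word a b l then cycle_position a b l + b else cycle_position a b l - a)"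
proof -
  have lt: "cycle_position a b l < a + b" using assms by (simp add: cycle_position_def)
  have "cycle_position a b (Suc l) = (cycle_position a b l + b) mod (a + b)"
    unfolding cycle_position_def mod_add_left_eq by (simp add: add.commute)
  also have "\<dots> = (if cycle_word a b l then cycle_position a b l + b else cycle_position a b l - a)"
  proof (cases "cycle_word a b l")
    case True
    then show ?thesis by (simp add: cycle_word_def)
  next
    case False
    then have "cycle_position a b l + b = (cycle_position a b l - a) + (a + b)"
      by (simp add: cycle_word_def)
    then have "(cycle_position a b l + b) mod (a + b) = (cycle_position a b l - a) mod (a + b)"
      by (metis mod_add_self2)
    then show ?thesis using False lt by simp
  qed
  finally show ?thesis .
qed

text \<open>
Coprimality makes the walk visit every level of the window, so that it closes up only after
\<open>a + b\<close> steps.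
\<close>

lemma cycle_position_bij:
  assumes "coprime a b" "a + b > 0"
  shows "bij_betw (cycle_position a b) {..<a + b} {..<a + b}"
proof -
  have "inj_on (cycle_position a b) {..<a + b}"
  proof (rule inj_onI)
    fix l l' assume *: "l \<in> {..<a + b}" "l' \<in> {..<a + b}" "cycle_position a b l = cycle_position a b l'"
    then have "[l * b = l' * b] (mod (a + b))" by (simp add: cycle_position_def cong_def)
    moreover have "gcd b (b + a) = gcd b a" by simp
    then have "coprime b (a + b)"
      using assms(1) unfolding coprime_iff_gcd_eq_1 by (simp add: add.commute gcd.commute)
    ultimately have "[l = l'] (mod (a + b))" using cong_mult_rcancel_nat by blast
    then show "l = l'" using * by (simp add: cong_def)
  qed
  moreover have "cycle_position a b ` {..<a + b} \<subseteq> {..<a + b}"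
    using assms(2) by (auto simp: cycle_position_def)
  ultimately show ?thesis
    by (metis bij_betw_def endo_inj_surj finite_lessThan)
qed

text \<open>
From each level there is at most one edge for each letter, so the word follows a single walk; it
gives 0 when this walk leaves the levels \<open>{..<n}\<close>.
\<close>

lemma word_matrix_ladder_entry:
  fixes h :: "'n::finite \<Rightarrow> nat"
  assumes h: "bij_betw h UNIV {..<n}" and ab: "a + b > 0"
  shows "word_matrix (cycle_word a b) (ladder_pair h a b \<zeta>) k $ p $ q =
    (if h p = h q + cycle_position a b k \<and> (\<forall>l\<le>k. h q + cycle_position a b l < n)
     then \<Prod>l<k. \<zeta> (h q + step_index a (cycle_position a b l)) else 0)"
proof (induction k arbitrary: p)
  case 0
  have "h p = h q \<longleftrightarrow> p = q" using h by (auto simp: bij_betw_def inj_def)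
  moreover have "h q < n" using h by (auto simp: bij_betw_def)
  ultimately show ?case by (simp add: mat_def cycle_position_def)
next
  case (Suc k)
  let ?c = "cycle_position a b" and ?w = "cycle_word a b"
  let ?z = "ladder_pair h a b \<zeta>"
  let ?X = "if ?w k then fst ?z else snd ?z"
  let ?W = "word_matrix ?w ?z k"
  let ?pr = "\<lambda>k. \<Prod>l<k. \<zeta> (h q + step_index a (?c l))"
  have step: "word_matrix ?w ?z (Suc k) $ p $ q = (\<Sum>u\<in>UNIV. ?X $ p $ u * ?W $ u $ q)"
    by (simp add: matrix_matrix_mult_def)
  have hp: "h p < n" using h by (auto simp: bij_betw_def)
  show ?case
  proof (cases "\<forall>l\<le>k. h q + ?c l < n")
    case False
    then have "\<not> (\<forall>l\<le>Suc k. h q + ?c l < n)" by (meson le_SucI)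
    moreover have "?W $ u $ q = 0" for u using Suc False by auto
    ultimately show ?thesis unfolding step by auto
  next
    case True
    then have "h q + ?c k \<in> {..<n}" by simp
    then obtain u where u: "h u = h q + ?c k" using h unfolding bij_betw_def by (metis imageE)
    have unique: "h v = h q + ?c k \<longleftrightarrow> v = u" for v
      using h u by (auto simp: bij_betw_def inj_def)
    have "word_matrix ?w ?z (Suc k) $ p $ q = (\<Sum>v\<in>UNIV. if v = u then ?X $ p $ u * ?pr k else 0)"
      unfolding step Suc unique using True by (intro sum.cong) auto
    also have "\<dots> = ?X $ p $ u * ?pr k" by simp
    also have "?X $ p $ u = (if h p = h q + ?c (Suc k) then \<zeta> (h q + step_index a (?c k)) else 0)"
    proof (cases "?w k")
      case True
      then show ?thesis
        using cycle_position_Suc[OF ab, of k] u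
        by (auto simp: ladder_pair_def step_index_def cycle_word_def)
    next
      case False
      then have "a \<le> ?c k" by (simp add: cycle_word_def)
      then show ?thesis
        using cycle_position_Suc[OF ab, of k] u False
        by (auto simp: ladder_pair_def step_index_def cycle_word_def)
    qed
    finally have "word_matrix ?w ?z (Suc k) $ p $ q = (if h p = h q + ?c (Suc k) then ?pr (Suc k) else 0)"
      by (simp add: mult.commute)
    moreover have "(\<forall>l\<le>Suc k. h q + ?c l < n)" if "h p = h q + ?c (Suc k)"
      using True hp that by (metis le_Suc_eq)
    ultimately show ?thesis by auto
  qed
qed

text \<open>
The word is diagonal, and its entry at level \<open>i\<close> is 0 unless the whole window
\<open>{i..<i + a + b}\<close> is available, since the walk visits the top of the window.  The \<open>a + b - 1\<close>
remaining levels contribute the power of \<open>c\<close>.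
\<close>

lemma det_ladder_cycle:
  fixes h :: "'n::finite \<Rightarrow> nat" and \<zeta> :: "nat \<Rightarrow> 'a::field"
  assumes h: "bij_betw h UNIV {..<n}" and ab: "coprime a b" "a + b > 0" "a + b \<le> n"
  shows "det (mat c - word_matrix (cycle_word a b) (ladder_pair h a b \<zeta>) (a + b)) =
    c ^ (a + b - 1) * (\<Prod>i<n + 1 - (a + b). c - cycle_weight a b i \<zeta>)"
proof -
  let ?r = "n + 1 - (a + b)"
  let ?W = "word_matrix (cycle_word a b) (ladder_pair h a b \<zeta>) (a + b)"
  have pos: "(\<forall>l\<le>a + b. i + cycle_position a b l < n) \<longleftrightarrow> i < ?r" for i
  proof
    assume *: "\<forall>l\<le>a + b. i + cycle_position a b l < n"
    have "a + b - 1 \<in> cycle_position a b ` {..<a + b}"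
      using cycle_position_bij[OF ab(1,2)] ab(2) by (simp add: bij_betw_def)
    then obtain l where "l < a + b" "cycle_position a b l = a + b - 1" by auto
    then have "i + (a + b - 1) < n" using * by (metis less_imp_le)
    then show "i < ?r" by linarith
  next
    assume i: "i < ?r"
    show "\<forall>l\<le>a + b. i + cycle_position a b l < n"
    proof (intro allI impI)
      fix l
      have "cycle_position a b l < a + b" using ab(2) by (simp add: cycle_position_def)
      then show "i + cycle_position a b l < n" using i by linarith
    qed
  qed
  have weight: "(\<Prod>l<a + b. \<zeta> (i + step_index a (cycle_position a b l))) = cycle_weight a b i \<zeta>" for i
    unfolding cycle_weight_def
    by (rule prod.reindex_bij_betw[OF cycle_position_bij[OF ab(1,2)], of "\<lambda>c. \<zeta> (i + step_index a c)"])
  have W: "?W $ p $ q = (if p = q \<and> h q < ?r then cycle_weight a b (h q) \<zeta> else 0)" for p q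
  proof -
    have "h p = h q \<longleftrightarrow> p = q" using h by (auto simp: bij_betw_def inj_def)
    moreover have "cycle_position a b (a + b) = 0" by (simp add: cycle_position_def)
    ultimately show ?thesis
      unfolding word_matrix_ladder_entry[OF h ab(2)] pos weight by simp
  qed
  have "det (mat c - ?W) = (\<Prod>p\<in>UNIV. (mat c - ?W) $ p $ p)"
    by (rule det_diagonal) (simp add: W mat_def)
  also have "\<dots> = (\<Prod>p\<in>UNIV. c - (if h p < ?r then cycle_weight a b (h p) \<zeta> else 0))"
    by (simp add: W mat_def)
  also have "\<dots> = (\<Prod>i<n. c - (if i < ?r then cycle_weight a b i \<zeta> else 0))"
    by (rule prod.reindex_bij_betw[OF h])
  also have "{..<n} = {..<?r} \<union> {?r..<n}" using ab by auto
  also have "(\<Prod>i\<in>{..<?r} \<union> {?r..<n}. c - (if i < ?r then cycle_weight a b i \<zeta> else 0)) =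
      (\<Prod>i<?r. c - cycle_weight a b i \<zeta>) * (\<Prod>i\<in>{?r..<n}. c)"
    by (subst prod.union_disjoint) (auto intro!: arg_cong2[of _ _ _ _ "(*)"] prod.cong)
  also have "(\<Prod>i\<in>{?r..<n}. c) = c ^ (a + b - 1)" using ab by simp
  finally show ?thesis by (simp add: mult.commute)
qed

lemma digits_unique:
  fixes m m' :: "nat \<Rightarrow> nat"
  assumes "\<And>i. i < r \<Longrightarrow> m i < D" "\<And>i. i < r \<Longrightarrow> m' i < D"
    and "(\<Sum>i<r. m i * D ^ i) = (\<Sum>i<r. m' i * D ^ i)" and "i < r"
  shows "m i = m' i"
  using assms
proof (induction r arbitrary: m m' i)
  case (Suc r)
  have shift: "(\<Sum>i<Suc r. m i * D ^ i) = m 0 + D * (\<Sum>i<r. m (Suc i) * D ^ i)" for m :: "nat \<Rightarrow> nat"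
    by (simp add: sum.lessThan_Suc_shift sum_distrib_left mult_ac del: sum.lessThan_Suc)
  have lt: "m 0 < D" "m' 0 < D" using Suc.prems(1,2)[of 0] by auto
  have eq: "m 0 + D * (\<Sum>i<r. m (Suc i) * D ^ i) = m' 0 + D * (\<Sum>i<r. m' (Suc i) * D ^ i)"
    using Suc.prems(3) unfolding shift .
  from arg_cong[OF eq, of "\<lambda>x. x mod D"] have 0: "m 0 = m' 0" using lt by simp
  then have tails: "(\<Sum>i<r. m (Suc i) * D ^ i) = (\<Sum>i<r. m' (Suc i) * D ^ i)" using eq lt by simp
  show ?case
  proof (cases i)
    case (Suc j)
    have "m (Suc j) = m' (Suc j)"
      by (rule Suc.IH[OF _ _ tails]) (use Suc.prems Suc in auto)
    then show ?thesis using Suc by simp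
  qed (use 0 in simp)
qed simp

text \<open>
Substituting \<open>\<zeta> j = t ^ (D ^ j)\<close> turns the cycle weight at level \<open>i\<close> into \<open>t ^ (s * D ^ i)\<close>, where
\<open>s > 0\<close> does not depend on \<open>i\<close>.  A monomial with exponents \<open>m i < D\<close> becomes the power of \<open>t\<close> whose
exponent is \<open>s\<close> times the number with base \<open>D\<close> digits \<open>m i\<close>.  So distinct monomials become distinct
powers of one variable.
\<close>

lemma cycle_weights_independent:
  assumes "a + b > 0"
  shows "independent_family {..<r} (\<lambda>i (\<zeta> :: nat \<Rightarrow> 'a::field_char_0). cycle_weight a b i \<zeta>)"
  unfolding independent_family_def
proof (intro allI impI ballI)
  fix D :: nat and c :: "(nat \<Rightarrow> nat) \<Rightarrow> 'a" and m0
  let ?box = "{..<r} \<rightarrow>\<^sub>E {..<D}"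
  assume rel: "\<forall>\<zeta>. (\<Sum>m\<in>?box. c m * (\<Prod>i<r. cycle_weight a b i \<zeta> ^ m i)) = 0" and m0: "m0 \<in> ?box"
  define s where "s = (\<Sum>c<a + b. D ^ step_index a c)"
  have s: "s > 0"
  proof -
    have "D ^ step_index a 0 \<le> s" unfolding s_def by (rule member_le_sum) (use assms in auto)
    then show ?thesis by (simp add: step_index_def split: if_splits)
  qed
  define N where "N = (\<lambda>m. s * (\<Sum>i<r. m i * D ^ i))"
  have weight: "cycle_weight a b i (\<lambda>j. t ^ (D ^ j)) = t ^ (s * D ^ i)" for i and t :: 'a
  proof -
    have "cycle_weight a b i (\<lambda>j. t ^ (D ^ j)) = (\<Prod>c<a + b. t ^ (D ^ i * D ^ step_index a c))"
      by (simp add: cycle_weight_def power_add)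
    also have "\<dots> = t ^ (D ^ i * s)"
      by (simp only: s_def sum_distrib_left power_sum)
    finally show ?thesis by (simp only: mult.commute)
  qed
  have eval: "(\<Prod>i<r. cycle_weight a b i (\<lambda>j. t ^ (D ^ j)) ^ m i) = t ^ N m" for t :: 'a and m
  proof -
    have "(\<Prod>i<r. cycle_weight a b i (\<lambda>j. t ^ (D ^ j)) ^ m i) = (\<Prod>i<r. t ^ (s * (m i * D ^ i)))"
      by (rule prod.cong) (simp_all add: weight mult_ac flip: power_mult)
    then show ?thesis by (simp only: N_def sum_distrib_left power_sum)
  qed
  have "(\<Sum>m\<in>?box. c m * t ^ N m) = 0" for t
    using spec[OF rel, of "\<lambda>j. t ^ (D ^ j)"] unfolding eval .
  then have "poly (\<Sum>m\<in>?box. monom (c m) (N m)) t = 0" for t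
    by (simp add: poly_sum poly_monom)
  then have zero: "(\<Sum>m\<in>?box. monom (c m) (N m)) = 0" using poly_all_0_iff_0 by blast
  have inj: "m = m0" if "m \<in> ?box" "N m = N m0" for m
  proof (rule PiE_ext[OF that(1) m0])
    fix i assume "i \<in> {..<r}"
    then show "m i = m0 i"
      using that m0 s by (intro digits_unique[of r m D m0]) (auto simp: N_def)
  qed
  have "0 = coeff (\<Sum>m\<in>?box. monom (c m) (N m)) (N m0)" by (simp add: zero)
  also have "\<dots> = (\<Sum>m\<in>?box. if m = m0 then c m else 0)"
    unfolding coeff_sum by (intro sum.cong) (auto dest: inj)
  also have "\<dots> = c m0" using m0 by (simp add: finite_PiE)
  finally show "c m0 = 0" by simp
qed

section \<open>Integrality of the cycle weights\<close>

text \<open>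
Every \<open>z j\<close> is a root of the monic polynomial with roots \<open>z 0, ..., z (r - 1)\<close>.  Lagrange interpolation
expresses its coefficients linearly through its values at the fixed nodes \<open>x k\<close>, with constants
that do not depend on \<open>z\<close>.  This is an equation of integral dependence whose coefficients can be
recognized as invariants through values of characteristic polynomials alone.
\<close>

lemma power_by_interpolation:
  fixes x :: "nat \<Rightarrow> 'a::field"
  assumes x: "inj_on x {..<r}"
  shows "\<exists>\<mu> \<nu>. \<forall>z. \<forall>j<r. z j ^ r =
    (\<Sum>e<r. (\<mu> e + (\<Sum>k<r. \<nu> k e * (\<Prod>i<r. x k - z i))) * z j ^ e)"
proof -
  \<comment> \<open>The monic polynomial that vanishes at the nodes, and the Lagrange basis.\<close>
  define V where "V = (\<Prod>k<r. [:- x k, 1:])"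
  define L where "L = (\<lambda>k. smult (inverse (\<Prod>i\<in>{..<r} - {k}. x k - x i)) (\<Prod>i\<in>{..<r} - {k}. [:- x i, 1:]))"
  have degree_prod: "degree (\<Prod>i\<in>A. [:- y i, 1:]) = card A" "coeff (\<Prod>i\<in>A. [:- y i, 1:]) (card A) = 1"
    if "finite A" for A and y :: "nat \<Rightarrow> 'a"
  proof -
    show *: "degree (\<Prod>i\<in>A. [:- y i, 1:]) = card A"
      by (subst degree_prod_eq_sum_degree) auto
    show "coeff (\<Prod>i\<in>A. [:- y i, 1:]) (card A) = 1"
      using lead_coeff_prod[of "\<lambda>i. [:- y i, 1:]" A] unfolding * by simp
  qed
  have degV: "degree V = r" "coeff V r = 1" using degree_prod[of "{..<r}" x] by (simp_all add: V_def)
  have degL: "degree (L k) < r" if "k < r" for k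
  proof -
    have "degree (L k) \<le> card ({..<r} - {k})"
      unfolding L_def using degree_prod(1)[of "{..<r} - {k}" x] degree_smult_le by (metis finite_Diff finite_lessThan)
    then show ?thesis using that by (simp add: card_Diff_singleton)
  qed
  have polyL: "poly (L k) (x l) = (if k = l then 1 else 0)" if "k < r" "l < r" for k l
  proof -
    have "(\<Prod>i\<in>{..<r} - {k}. x k - x i) \<noteq> 0" using x that(1) by (auto simp: inj_on_def)
    moreover have "(\<Prod>i\<in>{..<r} - {k}. x l - x i) = 0" if "k \<noteq> l"
      using \<open>l < r\<close> that by (intro prod_zero) auto
    ultimately show ?thesis by (auto simp: L_def poly_prod)
  qed
  have polyV: "poly V (x l) = 0" if "l < r" for l
    using that unfolding V_def poly_prod by (intro prod_zero) auto
  define E where "E = (\<lambda>z k. \<Prod>i<r. x k - z i)"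
  have main: "z j ^ r = (\<Sum>e<r. (- coeff V e + (\<Sum>k<r. - coeff (L k) e * E z k)) * z j ^ e)"
    if j: "j < r" for z j
  proof -
    have "(\<Prod>i<r. [:- z i, 1:]) = V + (\<Sum>k<r. smult (E z k) (L k))"
    proof (rule poly_eqI_degree_lead_coeff[of _ r _ "x ` {..<r}"])
      have "coeff (\<Sum>k<r. smult (E z k) (L k)) r = 0"
        unfolding coeff_sum by (rule sum.neutral) (auto simp: coeff_eq_0 degL)
      then show "coeff (\<Prod>i<r. [:- z i, 1:]) r = coeff (V + (\<Sum>k<r. smult (E z k) (L k))) r"
        using degree_prod(2)[of "{..<r}" z] degV by simp
      show "r \<le> card (x ` {..<r})" using x by (simp add: card_image)
      show "degree (\<Prod>i<r. [:- z i, 1:]) \<le> r" using degree_prod(1)[of "{..<r}" z] by simp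
      have "degree (\<Sum>k<r. smult (E z k) (L k)) \<le> r"
        by (rule degree_sum_le) (use degL in \<open>auto intro: order.trans[OF degree_smult_le] less_imp_le\<close>)
      then show "degree (V + (\<Sum>k<r. smult (E z k) (L k))) \<le> r"
        using degV by (intro degree_add_le) auto
      fix y assume "y \<in> x ` {..<r}"
      then obtain l where l: "l < r" "y = x l" by auto
      have "poly (\<Sum>k<r. smult (E z k) (L k)) y = (\<Sum>k<r. if k = l then E z k else 0)"
        unfolding poly_sum by (intro sum.cong) (auto simp: l polyL)
      then show "poly (\<Prod>i<r. [:- z i, 1:]) y = poly (V + (\<Sum>k<r. smult (E z k) (L k))) y"
        using l by (simp add: polyV poly_prod E_def)
    qed
    note decomposition = this
    have "poly (\<Prod>i<r. [:- z i, 1:]) (z j) = 0"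
      unfolding poly_prod by (rule prod_zero) (use j in auto)
    moreover have "poly V (z j) = z j ^ r + (\<Sum>e<r. coeff V e * z j ^ e)"
      unfolding poly_altdef degV(1) by (simp add: degV lessThan_Suc_atMost[symmetric])
    moreover have "poly (L k) (z j) = (\<Sum>e<r. coeff (L k) e * z j ^ e)" if "k < r" for k
      unfolding poly_altdef using degL[OF that]
      by (intro sum.mono_neutral_left) (auto simp: coeff_eq_0)
    then have "poly (\<Sum>k<r. smult (E z k) (L k)) (z j) =
        (\<Sum>k<r. \<Sum>e<r. E z k * (coeff (L k) e * z j ^ e))"
      by (simp add: poly_sum sum_distrib_left)
    moreover have "(\<Sum>k<r. \<Sum>e<r. E z k * (coeff (L k) e * z j ^ e)) =
        (\<Sum>e<r. (\<Sum>k<r. coeff (L k) e * E z k) * z j ^ e)"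
      by (subst sum.swap) (simp add: sum_distrib_left mult_ac)
    ultimately have "z j ^ r + ((\<Sum>e<r. coeff V e * z j ^ e) +
        (\<Sum>e<r. (\<Sum>k<r. coeff (L k) e * E z k) * z j ^ e)) = 0"
      by (simp only: decomposition poly_add add.assoc)
    then have "z j ^ r = - ((\<Sum>e<r. coeff V e * z j ^ e) +
        (\<Sum>e<r. (\<Sum>k<r. coeff (L k) e * E z k) * z j ^ e))"
      by (simp only: eq_neg_iff_add_eq_0)
    also have "\<dots> = (\<Sum>e<r. (- coeff V e + (\<Sum>k<r. - coeff (L k) e * E z k)) * z j ^ e)"
      by (simp add: left_diff_distrib sum_subtractf sum_negf)
    finally show ?thesis .
  qed
  show ?thesis
    by (intro exI[of _ "\<lambda>e. - coeff V e"] exI[of _ "\<lambda>k e. - coeff (L k) e"] allI impI)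
       (rule main[unfolded E_def])
qed

section \<open>Parameters along a ray\<close>

lemma bihomogeneous_scale:
  fixes f :: "('a::field, 'n::finite) mat_pair \<Rightarrow> 'a"
  assumes "bihomogeneous (d, e) f"
  shows "f (scale_matrix s x, scale_matrix t y) = s ^ d * t ^ e * f (x, y)"
proof -
  obtain p where p: "f = (\<lambda>z. mpoly_eval (coord_fun z) p)"
    and deg: "\<And>m. m \<in> Poly_Mapping.keys p \<Longrightarrow> monomial_bidegree m = (d, e)"
    using assms unfolding bihomogeneous_def by auto
  have mono: "(\<Prod>i\<in>Poly_Mapping.keys m. v i ^ Poly_Mapping.lookup m i) =
      (\<Prod>i\<in>UNIV. v (Inl i) ^ Poly_Mapping.lookup m (Inl i)) * (\<Prod>i\<in>UNIV. v (Inr i) ^ Poly_Mapping.lookup m (Inr i))"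
    for m :: "'n coord \<Rightarrow>\<^sub>0 nat" and v :: "'n coord \<Rightarrow> 'a"
    using prod.Plus[of UNIV UNIV "\<lambda>i. v i ^ Poly_Mapping.lookup m i"]
    by (simp add: monomial_eval_superset[of UNIV] comp_def)
  let ?z = "(scale_matrix s x, scale_matrix t y)"
  have "(\<Prod>i\<in>Poly_Mapping.keys m. coord_fun ?z i ^ Poly_Mapping.lookup m i) =
      s ^ d * t ^ e * (\<Prod>i\<in>Poly_Mapping.keys m. coord_fun (x, y) i ^ Poly_Mapping.lookup m i)"
    if m: "m \<in> Poly_Mapping.keys p" for m
  proof -
    have l: "coord_fun ?z (Inl i) = s * coord_fun (x, y) (Inl i)" for i
      by (cases i) (simp add: coord_fun_def scale_matrix_def)
    have r: "coord_fun ?z (Inr i) = t * coord_fun (x, y) (Inr i)" for i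
      by (cases i) (simp add: coord_fun_def scale_matrix_def)
    have "(\<Prod>i\<in>UNIV. s ^ Poly_Mapping.lookup m (Inl i)) = s ^ d"
      "(\<Prod>i\<in>UNIV. t ^ Poly_Mapping.lookup m (Inr i)) = t ^ e"
      using deg[OF m] by (simp_all add: monomial_bidegree_def flip: power_sum)
    then show ?thesis
      unfolding mono l r power_mult_distrib prod.distrib by (simp only: mult_ac)
  qed
  then show ?thesis
    unfolding p mpoly_eval_def sum_distrib_left by (intro sum.cong) (auto simp: mult_ac)
qed

lemma two_power_inject:
  assumes "(2 :: 'a::semiring_char_0) ^ k = 2 ^ l"
  shows "k = l"
proof -
  have "(of_nat (2 ^ k) :: 'a) = of_nat (2 ^ l)" using assms by simp
  then show "k = l" by (simp only: of_nat_eq_iff) simp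
qed

text \<open>
Conjugation by the diagonal matrix with entries \<open>2 ^ h p\<close> multiplies the first matrix by \<open>2 ^ b\<close> and
the second by \<open>2 ^ (- a)\<close>, hence \<open>f\<close> by \<open>2 ^ (b * d - a * e)\<close>.  As the characteristic is 0, this factor
is different from 1.
\<close>

lemma vanishes_on_ladder:
  fixes f :: "('a::field_char_0, 'n::finite) mat_pair \<Rightarrow> 'a"
  assumes f: "f \<in> pair_invariants" "bihomogeneous (d, e) f" and ray: "b * d \<noteq> a * e"
  shows "f (ladder_pair h a b \<zeta>) = 0"
proof -
  let ?g = "(\<chi> p q. if p = q then 2 ^ h p else 0) :: 'a^'n^'n"
  obtain x y where xy: "ladder_pair h a b \<zeta> = (x, y)" by fastforce
  have "det ?g = (\<Prod>p\<in>UNIV. 2 ^ h p)" by (subst det_diagonal) auto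
  then have inv: "invertible ?g" by (simp add: invertible_det_nz)
  have left: "(?g ** M) $ p $ q = 2 ^ h p * M $ p $ q" for M :: "'a^'n^'n" and p q
    by (simp add: matrix_matrix_mult_def if_distrib if_distribR sum.delta cong: if_cong)
  have right: "(M ** ?g) $ p $ q = M $ p $ q * 2 ^ h q" for M :: "'a^'n^'n" and p q
    by (simp add: matrix_matrix_mult_def if_distrib if_distribR sum.delta' cong: if_cong)
  have "?g ** x = scale_matrix (2 ^ b) x ** ?g"
  proof -
    have "2 ^ h p * x $ p $ q = 2 ^ b * x $ p $ q * 2 ^ h q" for p q
    proof (cases "h p = h q + b")
      case False
      then have "x $ p $ q = 0" using xy by (auto simp: ladder_pair_def)
      then show ?thesis by simp
    qed (simp add: power_add)
    then show ?thesis by (simp add: vec_eq_iff left right scale_matrix_def)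
  qed
  moreover have "?g ** y = scale_matrix (inverse (2 ^ a)) y ** ?g"
  proof -
    have "2 ^ h p * y $ p $ q = inverse (2 ^ a) * y $ p $ q * 2 ^ h q" for p q
    proof (cases "h p + a = h q")
      case True
      then have "(2 :: 'a) ^ h q = 2 ^ h p * 2 ^ a" by (simp flip: power_add)
      then show ?thesis by simp
    next
      case False
      then have "y $ p $ q = 0" using xy by (auto simp: ladder_pair_def)
      then show ?thesis by simp
    qed
    then show ?thesis by (simp add: vec_eq_iff left right scale_matrix_def)
  qed
  ultimately have "simultaneous_conj ?g (x, y) = (scale_matrix (2 ^ b) x, scale_matrix (inverse (2 ^ a)) y)"
    using conj_unique[OF inv] by (simp add: simultaneous_conj_def)
  moreover have "f (simultaneous_conj ?g (x, y)) = f (x, y)"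
    using f(1) inv unfolding pair_invariants_def by blast
  ultimately have "f (x, y) = (2 ^ b) ^ d * (inverse (2 ^ a)) ^ e * f (x, y)"
    by (simp only: bihomogeneous_scale[OF f(2)])
  then have "f (x, y) * 2 ^ (a * e) = f (x, y) * 2 ^ (b * d)"
    by (simp add: power_mult power_inverse field_simps)
  moreover have "(2 :: 'a) ^ (a * e) \<noteq> 2 ^ (b * d)"
    using ray two_power_inject[of "a * e" "b * d"] by auto
  ultimately show ?thesis by (simp add: xy)
qed

lemma module_span_base:
  assumes "finite B" "b \<in> B" "r \<in> subalgebra_gen G"
  shows "(\<lambda>y. r y * b y) \<in> module_span (subalgebra_gen G) B"
proof -
  let ?r = "\<lambda>b'. if b' = b then r else (\<lambda>_. 0)"
  have "(\<Sum>b'\<in>B. ?r b' y * b' y) = (\<Sum>b'\<in>{b}. ?r b' y * b' y)" for y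
    by (rule sum.mono_neutral_right) (use assms in auto)
  then have "(\<lambda>y. r y * b y) = (\<lambda>y. \<Sum>b'\<in>B. ?r b' y * b' y)" by simp
  moreover have "\<forall>b'\<in>B. ?r b' \<in> subalgebra_gen G" using assms(3) by (auto intro: subalgebra_gen.const)
  ultimately show ?thesis unfolding module_span_def by (intro CollectI exI[of _ ?r]) simp
qed

lemma module_span_add:
  assumes "f \<in> module_span (subalgebra_gen G) B" "g \<in> module_span (subalgebra_gen G) B"
  shows "(\<lambda>y. f y + g y) \<in> module_span (subalgebra_gen G) B"
proof -
  obtain r r' where "\<forall>b\<in>B. r b \<in> subalgebra_gen G" "f = (\<lambda>y. \<Sum>b\<in>B. r b y * b y)"
    "\<forall>b\<in>B. r' b \<in> subalgebra_gen G" "g = (\<lambda>y. \<Sum>b\<in>B. r' b y * b y)"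
    using assms unfolding module_span_def by auto
  then show ?thesis
    unfolding module_span_def
    by (intro CollectI exI[of _ "\<lambda>b y. r b y + r' b y"])
       (auto simp: distrib_right sum.distrib intro: subalgebra_gen.add)
qed

lemma module_span_sum:
  "(\<And>i. i \<in> I \<Longrightarrow> f i \<in> module_span (subalgebra_gen G) B) \<Longrightarrow>
    (\<lambda>y. \<Sum>i\<in>I. f i y) \<in> module_span (subalgebra_gen G) B"
proof (induction I rule: infinite_finite_induct)
  case (insert i I)
  then show ?case by (auto intro: module_span_add)
qed (auto simp: module_span_def intro!: exI[of _ "\<lambda>_ _. 0"] intro: subalgebra_gen.const)

text \<open>
The restrictions of the invariants to the ladder form a finite module over the algebra generated by
the restricted parameters, and those off the ray restrict to 0.  Adjoining the cycle weights keeps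
the module finite: by integrality the monomials in the weights with exponents below their number
suffice, multiplied by the generators \<open>B\<close> of the module.  The weights are independent, so their number
is at most the number of parameters on the ray.
\<close>

theorem card_parameters_on_ray_ge:
  fixes S :: "(('a::field_char_0, 'n::finite) mat_pair \<Rightarrow> 'a) set"
  assumes S: "bigraded_system_of_parameters S"
    and ab: "coprime a b" "a + b > 0" "a + b \<le> CARD('n)"
  shows "CARD('n) + 1 - (a + b) \<le>
    card {P \<in> S. \<exists>d e. d + e > 0 \<and> bihomogeneous (d, e) P \<and> b * d = a * e}"
    (is "_ \<le> card ?T")
proof -
  let ?n = "CARD('n)"
  let ?r = "?n + 1 - (a + b)"
  obtain h :: "'n \<Rightarrow> nat" where h: "bij_betw h UNIV {..<?n}"
    using ex_bij_betw_finite_nat[of "UNIV :: 'n set"] by (auto simp: atLeast0LessThan)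
  let ?\<phi> = "ladder_pair h a b :: (nat \<Rightarrow> 'a) \<Rightarrow> ('a, 'n) mat_pair"
  let ?z = "\<lambda>i. cycle_weight a b i :: (nat \<Rightarrow> 'a) \<Rightarrow> 'a"
  let ?R = "subalgebra_gen ((\<lambda>P \<zeta>. P (?\<phi> \<zeta>)) ` ?T)"
  have fin: "finite S" "finite ?T" and inv: "S \<subseteq> pair_invariants"
    using S by (auto simp: bigraded_system_of_parameters_def)
  have "finitely_generated_over pair_invariants (generated_subalgebra S)"
    using S by (simp add: bigraded_system_of_parameters_def)
  then obtain B where B: "finite B" "B \<subseteq> pair_invariants"
    and gen: "\<forall>f\<in>pair_invariants. \<exists>r. (\<forall>b\<in>B. r b \<in> generated_subalgebra S) \<and>
      f = (\<lambda>z. \<Sum>b\<in>B. r b z * b z)"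
    unfolding finitely_generated_over_def by (elim exE conjE)
  have restrict: "(\<lambda>\<zeta>. r (?\<phi> \<zeta>)) \<in> ?R" if "r \<in> generated_subalgebra S" for r
  proof (rule subalgebra_gen_comp[where f = r and \<phi> = ?\<phi>])
    show "r \<in> subalgebra_gen S" using that generated_subalgebra_subset by blast
    fix P assume P: "P \<in> S"
    show "(\<lambda>\<zeta>. P (?\<phi> \<zeta>)) \<in> ?R"
    proof (cases "P \<in> ?T")
      case False
      have "\<exists>d e. d + e > 0 \<and> bihomogeneous (d, e) P"
        using P S unfolding bigraded_system_of_parameters_def by blast
      then obtain d e where de: "d + e > 0" "bihomogeneous (d, e) P" by (elim exE conjE)
      have "b * d \<noteq> a * e"
      proof
        assume "b * d = a * e"
        with de P have "P \<in> ?T" by (intro CollectI conjI exI[of _ d] exI[of _ e])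
        then show False using False by simp
      qed
      then have "P (?\<phi> \<zeta>) = 0" for \<zeta>
        by (rule vanishes_on_ladder[OF subsetD[OF inv P] de(2)])
      then show ?thesis by (simp add: subalgebra_gen.const)
    qed (auto intro: subalgebra_gen.gen)
  qed
  let ?box = "{..<?r} \<rightarrow>\<^sub>E {..<?r}"
  define mon where "mon = (\<lambda>(m :: nat \<Rightarrow> nat) \<zeta>. \<Prod>i<?r. ?z i \<zeta> ^ m i)"
  define B' where "B' = (\<lambda>(m, b) \<zeta>. mon m \<zeta> * b (?\<phi> \<zeta>)) ` (?box \<times> B)"
  have finB': "finite B'" using B(1) by (simp add: B'_def finite_PiE)
  have box_mult: "(\<lambda>\<zeta>. mon m \<zeta> * f (?\<phi> \<zeta>)) \<in> module_span ?R B'"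
    if m: "m \<in> ?box" and f: "f \<in> pair_invariants" for m f
  proof -
    obtain r where r: "\<And>b. b \<in> B \<Longrightarrow> r b \<in> generated_subalgebra S" "f = (\<lambda>z. \<Sum>b\<in>B. r b z * b z)"
      using bspec[OF gen f] by auto
    have "(\<lambda>\<zeta>. \<Sum>b\<in>B. r b (?\<phi> \<zeta>) * (mon m \<zeta> * b (?\<phi> \<zeta>))) \<in> module_span ?R B'"
    proof (rule module_span_sum)
      fix b assume b: "b \<in> B"
      have "(\<lambda>\<zeta>. mon m \<zeta> * b (?\<phi> \<zeta>)) \<in> B'"
        unfolding B'_def using m b by (intro image_eqI[of _ _ "(m, b)"]) auto
      from module_span_base[OF finB' this restrict[OF r(1)[OF b]]]
      show "(\<lambda>\<zeta>. r b (?\<phi> \<zeta>) * (mon m \<zeta> * b (?\<phi> \<zeta>))) \<in> module_span ?R B'" .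
    qed
    moreover have "(\<lambda>\<zeta>. \<Sum>b\<in>B. r b (?\<phi> \<zeta>) * (mon m \<zeta> * b (?\<phi> \<zeta>))) = (\<lambda>\<zeta>. mon m \<zeta> * f (?\<phi> \<zeta>))"
      by (simp add: r(2) sum_distrib_left mult_ac)
    ultimately show ?thesis by simp
  qed
  \<comment> \<open>The nodes must be distinct and, to cancel the power of the node in the determinant, nonzero.\<close>
  have "inj_on (\<lambda>k. of_nat (Suc k) :: 'a) {..<?r}" by (auto simp: inj_on_def)
  from power_by_interpolation[OF this] obtain \<mu> \<nu> where interp:
    "\<forall>z. \<forall>j<?r. z j ^ ?r =
      (\<Sum>e<?r. (\<mu> e + (\<Sum>k<?r. \<nu> k e * (\<Prod>i<?r. (of_nat (Suc k) :: 'a) - z i))) * z j ^ e)"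
    by blast
  \<comment> \<open>These invariants restrict to the values, at the nodes, of the monic polynomial whose roots are
    the cycle weights.\<close>
  define E where "E = (\<lambda>k (z :: ('a, 'n) mat_pair). inverse (of_nat (Suc k) ^ (a + b - 1)) *
      det (mat (of_nat (Suc k)) - word_matrix (cycle_word a b) z (a + b)) :: 'a)"
  have E_inv: "E k \<in> (pair_invariants :: (('a, 'n) mat_pair \<Rightarrow> 'a) set)" for k
    unfolding E_def by (intro pair_invariants_mult pair_invariants_const det_word_matrix_invariant)
  have E_ladder: "E k (?\<phi> \<zeta>) = (\<Prod>i<?r. of_nat (Suc k) - ?z i \<zeta>)" for k \<zeta>
    unfolding E_def det_ladder_cycle[OF h ab] by (simp del: of_nat_Suc)
  have closed: "(\<lambda>\<zeta>. ?z j \<zeta> * b' \<zeta>) \<in> module_span ?R B'" if j: "j \<in> {..<?r}" and bB': "b' \<in> B'" for j b'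
  proof -
    obtain m b where m: "m \<in> ?box" "b \<in> B" and b': "b' = (\<lambda>\<zeta>. mon m \<zeta> * b (?\<phi> \<zeta>))"
      using bB' unfolding B'_def by auto
    define rest where "rest = (\<lambda>\<zeta>. \<Prod>i\<in>{..<?r} - {j}. ?z i \<zeta> ^ m i)"
    have mon_upd: "mon (m(j := e)) \<zeta> = ?z j \<zeta> ^ e * rest \<zeta>" for e \<zeta>
      unfolding mon_def rest_def using j by (subst prod.remove[of _ j]) (auto intro!: arg_cong2[of _ _ _ _ "(*)"] prod.cong)
    have upd_box: "m(j := e) \<in> ?box" if "e < ?r" for e
      using m(1) j that by (auto simp: PiE_iff extensional_def)
    have prod: "?z j \<zeta> * b' \<zeta> = mon (m(j := Suc (m j))) \<zeta> * b (?\<phi> \<zeta>)" for \<zeta>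
      using mon_upd[of "m j" \<zeta>] mon_upd[of "Suc (m j)" \<zeta>] by (simp add: b')
    have "m j < ?r" using m(1) j by auto
    then consider "Suc (m j) < ?r" | "Suc (m j) = ?r" by linarith
    then show ?thesis
    proof cases
      case 1
      show ?thesis unfolding prod by (rule box_mult[OF upd_box[OF 1] subsetD[OF B(2) m(2)]])
    next
      case 2
      \<comment> \<open>The exponent would leave the box; the equation of integral dependence brings it back.\<close>
      define F where "F = (\<lambda>e z. (\<mu> e + (\<Sum>k<?r. \<nu> k e * E k z)) * b z)"
      have F: "F e \<in> pair_invariants" for e
        unfolding F_def
        by (intro pair_invariants_mult pair_invariants_add pair_invariants_const pair_invariants_sum E_inv)
           (use m(2) B(2) in auto)
      have power: "?z j \<zeta> ^ ?r = (\<Sum>e<?r. (\<mu> e + (\<Sum>k<?r. \<nu> k e * E k (?\<phi> \<zeta>))) * ?z j \<zeta> ^ e)" for \<zeta>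
        unfolding E_ladder by (rule interp[rule_format, of j "\<lambda>i. ?z i \<zeta>"]) (use j in simp)
      have "?z j \<zeta> * b' \<zeta> = (\<Sum>e<?r. mon (m(j := e)) \<zeta> * F e (?\<phi> \<zeta>))" for \<zeta>
        unfolding prod 2 mon_upd power sum_distrib_right
        by (rule sum.cong) (simp_all only: F_def mult_ac)
      moreover have "(\<lambda>\<zeta>. \<Sum>e<?r. mon (m(j := e)) \<zeta> * F e (?\<phi> \<zeta>)) \<in> module_span ?R B'"
        by (intro module_span_sum box_mult upd_box F) simp
      ultimately show ?thesis by simp
    qed
  qed
  have one: "(\<lambda>_. 1) \<in> module_span ?R B'"
  proof -
    let ?m = "\<lambda>i\<in>{..<?r}. 0 :: nat"
    have "?m \<in> ?box" using ab by auto
    from box_mult[OF this pair_invariants_const[of 1]] show ?thesis by (simp add: mon_def)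
  qed
  have "card {..<?r} \<le> card ?T"
    by (rule independent_family_card_le[where B = B' and g = "\<lambda>P \<zeta>. P (?\<phi> \<zeta>)",
          OF _ fin(2) finB' cycle_weights_independent[OF ab(2)] one closed]) auto
  then show ?thesis by simp
qed

text \<open>
The zero function has every bidegree, whence the hypothesis on a nonzero value.
\<close>

lemma bidegree_unique:
  fixes f :: "('a::field_char_0, 'n::finite) mat_pair \<Rightarrow> 'a"
  assumes "bihomogeneous (d, e) f" "bihomogeneous (d', e') f" and nz: "f (x, y) \<noteq> 0"
  shows "d = d'" "e = e'"
proof -
  show "d = d'"
    using bihomogeneous_scale[OF assms(1), of 2 x 1 y] bihomogeneous_scale[OF assms(2), of 2 x 1 y] nz
    by (auto dest: two_power_inject)
  show "e = e'"
    using bihomogeneous_scale[OF assms(1), of 1 x 2 y] bihomogeneous_scale[OF assms(2), of 1 x 2 y] nz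
    by (auto dest: two_power_inject)
qed

lemma primitive_ray_unique:
  fixes a b a' b' d e :: nat
  assumes "coprime a b" "coprime a' b'" "b * d = a * e" "b' * d = a' * e" "d + e > 0"
  shows "a = a'" "b = b'"
proof -
  have "a * b' = a' * b"
  proof (cases "d = 0")
    case True
    then show ?thesis using assms by simp
  next
    case False
    have "d * (a * b') = a * (b' * d)" by (simp add: mult_ac)
    also have "\<dots> = a' * (a * e)" by (simp add: assms(4) mult_ac)
    also have "\<dots> = d * (a' * b)" by (simp add: assms(3)[symmetric] mult_ac)
    finally show ?thesis using False by simp
  qed
  then show "a = a'" "b = b'"
    using coprime_crossproduct_nat[OF assms(1,2)] by auto
qed

definition primitive_directions :: "nat \<Rightarrow> (nat \<times> nat) set" where
  "primitive_directions n = {(a, b). coprime a b \<and> 0 < a + b \<and> a + b \<le> n}"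

text \<open>
A parameter is not the zero function, so it has one bidegree, and this lies on one ray only.  The
lower bounds for different directions therefore add up.
\<close>

lemma sum_primitive_directions_le:
  fixes S :: "(('a::field_char_0, 'n::finite) mat_pair \<Rightarrow> 'a) set"
  assumes S: "bigraded_system_of_parameters S" and Q: "finite Q" "Q \<subseteq> primitive_directions CARD('n)"
  shows "(\<Sum>(a, b)\<in>Q. CARD('n) + 1 - (a + b)) \<le> CARD('n) ^ 2 + 1"
proof -
  define T where "T = (\<lambda>(a, b). {P \<in> S. \<exists>d e. d + e > 0 \<and> bihomogeneous (d, e) P \<and> b * d = a * e})"
  have fin: "finite S" and inv: "S \<subseteq> pair_invariants" and indep: "algebraically_independent S"
    using S by (auto simp: bigraded_system_of_parameters_def)
  have nonzero: "\<exists>z. P z \<noteq> 0" if P: "P \<in> S" for P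
  proof (rule ccontr)
    assume "\<nexists>z. P z \<noteq> 0"
    then have "P z = 0" for z by blast
    then have "mpoly_subst (Poly_Mapping.single (Poly_Mapping.single P 1) 1) = (\<lambda>_. 0 :: 'a)"
      by (simp add: mpoly_subst_def mpoly_eval_single)
    moreover have "mpoly_vars (Poly_Mapping.single (Poly_Mapping.single P 1) (1 :: 'a)) \<subseteq> S"
      using P by (simp add: mpoly_vars_def)
    ultimately have "Poly_Mapping.single (Poly_Mapping.single P (1 :: nat)) (1 :: 'a) = 0"
      using indep unfolding algebraically_independent_def by blast
    from arg_cong[OF this, of "\<lambda>p. Poly_Mapping.lookup p (Poly_Mapping.single P 1)"] show False by simp
  qed
  have "(\<Sum>(a, b)\<in>Q. CARD('n) + 1 - (a + b)) \<le> (\<Sum>q\<in>Q. card (T q))"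
  proof (rule sum_mono)
    fix q assume "q \<in> Q"
    then obtain a b where q: "q = (a, b)" "coprime a b" "a + b > 0" "a + b \<le> CARD('n)"
      using Q(2) unfolding primitive_directions_def by auto
    show "(case q of (a, b) \<Rightarrow> CARD('n) + 1 - (a + b)) \<le> card (T q)"
      unfolding q(1) T_def prod.case by (rule card_parameters_on_ray_ge[OF S q(2-4)])
  qed
  also have "\<dots> = card (\<Union>q\<in>Q. T q)"
  proof (rule card_UN_disjoint[symmetric, OF Q(1)])
    show "\<forall>q\<in>Q. finite (T q)" using fin by (auto simp: T_def)
    show "\<forall>q\<in>Q. \<forall>q'\<in>Q. q \<noteq> q' \<longrightarrow> T q \<inter> T q' = {}"
    proof (intro ballI impI)
      fix q q' assume q: "q \<in> Q" "q' \<in> Q" "q \<noteq> q'"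
      obtain a b a' b' where ab: "q = (a, b)" "q' = (a', b')" by fastforce
      show "T q \<inter> T q' = {}"
      proof (rule ccontr)
        assume "T q \<inter> T q' \<noteq> {}"
        then obtain P where TP: "P \<in> T q" "P \<in> T q'" by blast
        have P: "P \<in> S" using TP(1) by (simp add: T_def ab)
        have "\<exists>d e. d + e > 0 \<and> bihomogeneous (d, e) P \<and> b * d = a * e"
          using TP(1) unfolding T_def ab prod.case mem_Collect_eq by (rule conjunct2)
        then obtain d e where de: "d + e > 0" "bihomogeneous (d, e) P" "b * d = a * e"
          by (elim exE conjE)
        have "\<exists>d e. d + e > 0 \<and> bihomogeneous (d, e) P \<and> b' * d = a' * e"
          using TP(2) unfolding T_def ab prod.case mem_Collect_eq by (rule conjunct2)
        then obtain d' e' where de': "bihomogeneous (d', e') P" "b' * d' = a' * e'"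
          by (elim exE conjE)
        obtain x y where xy: "P (x, y) \<noteq> 0" using nonzero[OF P] by auto
        have eq: "d' = d" "e' = e" using bidegree_unique[OF de(2) de'(1) xy] by simp_all
        have "coprime a b" "coprime a' b'"
          using q(1,2) Q(2) unfolding ab primitive_directions_def by auto
        from primitive_ray_unique[OF this de(3) de'(2)[unfolded eq] de(1)] show False
          using q(3) ab by simp
      qed
    qed
  qed
  also have "\<dots> \<le> card S" by (rule card_mono) (use fin in \<open>auto simp: T_def\<close>)
  also have "\<dots> \<le> CARD('n) ^ 2 + 1" by (rule card_system_of_parameters_le[OF fin inv indep])
  finally show ?thesis .
qed

theorem proposition2p1:
  shows "\<not> (\<exists>S :: (('a::field_char_0, 5) mat_pair \<Rightarrow> 'a) set. bigraded_system_of_parameters S) \<and>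
         \<not> (\<exists>S :: (('a::field_char_0, 6) mat_pair \<Rightarrow> 'a) set. bigraded_system_of_parameters S)"
proof (intro conjI notI; elim exE)
  fix S :: "(('a, 5) mat_pair \<Rightarrow> 'a) set"
  assume S: "bigraded_system_of_parameters S"
  \<comment> \<open>The terms \<open>6 - (a + b)\<close> sum to 28, which exceeds 26.\<close>
  let ?Q = "{(1, 0), (0, 1), (1, 1), (1, 2), (2, 1), (1, 3), (3, 1), (2, 3), (3, 2), (1, 4), (4, 1)} :: (nat \<times> nat) set"
  have "?Q \<subseteq> primitive_directions CARD(5)"
    by (simp add: primitive_directions_def coprime_iff_gcd_eq_1 gcd_non_0_nat)
  from sum_primitive_directions_le[OF S _ this] show False by simp
next
  fix S :: "(('a, 6) mat_pair \<Rightarrow> 'a) set"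
  assume S: "bigraded_system_of_parameters S"
  \<comment> \<open>The terms \<open>7 - (a + b)\<close> sum to 41, which exceeds 37.\<close>
  let ?Q = "{(1, 0), (0, 1), (1, 1), (1, 2), (2, 1), (1, 3), (3, 1), (2, 3), (3, 2), (1, 4), (4, 1),
    (1, 5), (5, 1)} :: (nat \<times> nat) set"
  have "?Q \<subseteq> primitive_directions CARD(6)"
    by (simp add: primitive_directions_def coprime_iff_gcd_eq_1 gcd_non_0_nat)
  from sum_primitive_directions_le[OF S _ this] show False by simp
qed


end
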